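(* Assume the continuum hypothesis. Then for each nonmetrizable dyadic space $K$ there exists a nontrivial twisted sum of $c_0$ and $C(K)$.
   Context: Compact spaces are Hausdorff. A dyadic space (dyadic compactum) is a continuous image of some Cantor cube $2^\kappa=\{0,1\}^\kappa$. $C(K)$ is the Banach space of continuous real-valued functions on $K$. A twisted sum of Banach spaces $Z$ and $Y$ is a short exact sequence $0\to Z\to X\to Y\to 0$ with $X$ a Banach space and the maps bounded linear operators; it is trivial if it splits (the map $Z\to X$ has a bounded linear left inverse; equivalently, its range is complemented in $X$), and nontrivial otherwise. *)

theory Defs
  imports "HOL-Analysis.Analysis"
begin

section \<open>Banach spaces on explicit carriers\<close>

text \<open>
  The middle space of a twisted sum is existentially quantified, so Banach spaces are represented as
  structures with an explicit carrier set rather than as types of class \<open>banach\<close>.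
\<close>

record 'v normed_structure =
  vcarrier :: "'v set"
  vzero :: 'v
  vadd :: "'v \<Rightarrow> 'v \<Rightarrow> 'v"
  vscale :: "real \<Rightarrow> 'v \<Rightarrow> 'v"
  vnorm :: "'v \<Rightarrow> real"

text \<open>
  The default value off the carrier is needed because \<open>Metric_space\<close> requires nonnegativity and
  symmetry of the distance on the whole type.
\<close>

definition vdist :: "'v normed_structure \<Rightarrow> 'v \<Rightarrow> 'v \<Rightarrow> real" where
  "vdist V x y =
    (if x \<in> vcarrier V \<and> y \<in> vcarrier V then vnorm V (vadd V x (vscale V (-1) y)) else 0)"

locale normed_space =
  fixes V :: "'v normed_structure"
  assumes zero_closed: "vzero V \<in> vcarrier V"
    and add_closed: "\<lbrakk>x \<in> vcarrier V; y \<in> vcarrier V\<rbrakk> \<Longrightarrow> vadd V x y \<in> vcarrier V"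
    and scale_closed: "x \<in> vcarrier V \<Longrightarrow> vscale V a x \<in> vcarrier V"
    and add_assoc: "\<lbrakk>x \<in> vcarrier V; y \<in> vcarrier V; z \<in> vcarrier V\<rbrakk>
      \<Longrightarrow> vadd V (vadd V x y) z = vadd V x (vadd V y z)"
    and add_commute: "\<lbrakk>x \<in> vcarrier V; y \<in> vcarrier V\<rbrakk> \<Longrightarrow> vadd V x y = vadd V y x"
    and add_zero: "x \<in> vcarrier V \<Longrightarrow> vadd V (vzero V) x = x"
    and add_inverse: "x \<in> vcarrier V \<Longrightarrow> vadd V x (vscale V (-1) x) = vzero V"
    and scale_add_right: "\<lbrakk>x \<in> vcarrier V; y \<in> vcarrier V\<rbrakk>
      \<Longrightarrow> vscale V a (vadd V x y) = vadd V (vscale V a x) (vscale V a y)"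
    and scale_add_left: "x \<in> vcarrier V
      \<Longrightarrow> vscale V (a + b) x = vadd V (vscale V a x) (vscale V b x)"
    and scale_scale: "x \<in> vcarrier V \<Longrightarrow> vscale V a (vscale V b x) = vscale V (a * b) x"
    and scale_one: "x \<in> vcarrier V \<Longrightarrow> vscale V 1 x = x"
    and norm_eq_zero: "x \<in> vcarrier V \<Longrightarrow> vnorm V x = 0 \<longleftrightarrow> x = vzero V"
    and norm_scale: "x \<in> vcarrier V \<Longrightarrow> vnorm V (vscale V a x) = \<bar>a\<bar> * vnorm V x"
    and norm_triangle: "\<lbrakk>x \<in> vcarrier V; y \<in> vcarrier V\<rbrakk>
      \<Longrightarrow> vnorm V (vadd V x y) \<le> vnorm V x + vnorm V y"
begin

lemma scale_zero: "x \<in> vcarrier V \<Longrightarrow> vscale V 0 x = vzero V"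
  using scale_add_left[of x 1 "-1"] by (simp add: scale_one add_inverse)

lemma norm_nonneg: assumes "x \<in> vcarrier V" shows "0 \<le> vnorm V x"
proof -
  have "vnorm V (vadd V x (vscale V (-1) x)) \<le> vnorm V x + vnorm V (vscale V (-1) x)"
    using assms by (intro norm_triangle scale_closed)
  moreover have "vnorm V (vadd V x (vscale V (-1) x)) = 0"
    using assms zero_closed norm_eq_zero by (simp add: add_inverse)
  ultimately show ?thesis using assms by (simp add: norm_scale)
qed

lemma diff_swap:
  assumes "x \<in> vcarrier V" "y \<in> vcarrier V"
  shows "vscale V (-1) (vadd V x (vscale V (-1) y)) = vadd V y (vscale V (-1) x)"
  using assms by (simp add: scale_add_right scale_scale scale_one scale_closed add_commute)

lemma diff_add:
  assumes "x \<in> vcarrier V" "y \<in> vcarrier V" "z \<in> vcarrier V"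
  shows "vadd V (vadd V x (vscale V (-1) y)) (vadd V y (vscale V (-1) z)) =
    vadd V x (vscale V (-1) z)"
proof -
  have "vadd V (vscale V (-1) y) (vadd V y (vscale V (-1) z)) =
    vadd V (vadd V y (vscale V (-1) y)) (vscale V (-1) z)"
    using assms by (metis add_assoc add_commute scale_closed)
  then show ?thesis
    using assms by (simp add: add_assoc scale_closed add_closed add_inverse add_zero)
qed

lemma vdist_metric: "Metric_space (vcarrier V) (vdist V)"
proof
  show "0 \<le> vdist V x y" for x y
    by (simp add: vdist_def norm_nonneg add_closed scale_closed)
  show "vdist V x y = vdist V y x" for x y
  proof (cases "x \<in> vcarrier V \<and> y \<in> vcarrier V")
    case True
    then have "vnorm V (vscale V (-1) (vadd V x (vscale V (-1) y))) =
      vnorm V (vadd V x (vscale V (-1) y))"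
      by (simp add: norm_scale add_closed scale_closed)
    with True show ?thesis by (simp add: vdist_def diff_swap)
  qed (auto simp: vdist_def)
  show "vdist V x y = 0 \<longleftrightarrow> x = y" if "x \<in> vcarrier V" "y \<in> vcarrier V" for x y
  proof
    assume "vdist V x y = 0"
    then have "vadd V x (vscale V (-1) y) = vzero V"
      using that by (simp add: vdist_def norm_eq_zero add_closed scale_closed)
    then have "vadd V (vadd V x (vscale V (-1) y)) y = y"
      using that by (simp add: add_zero)
    moreover have "vadd V (vadd V x (vscale V (-1) y)) y = vadd V x (vadd V y (vscale V (-1) y))"
      using that by (metis add_assoc add_commute scale_closed)
    ultimately show "x = y"
      using that by (metis add_inverse add_commute add_zero zero_closed)
  next
    assume "x = y"
    then show "vdist V x y = 0"
      using that norm_eq_zero zero_closed by (simp add: vdist_def add_inverse)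
  qed
  show "vdist V x z \<le> vdist V x y + vdist V y z"
    if "x \<in> vcarrier V" "y \<in> vcarrier V" "z \<in> vcarrier V" for x y z
    using norm_triangle[of "vadd V x (vscale V (-1) y)" "vadd V y (vscale V (-1) z)"] that
    by (simp add: vdist_def diff_add add_closed scale_closed)
qed

end

locale banach_space = normed_space +
  assumes complete: "Metric_space.mcomplete (vcarrier V) (vdist V)"

lemma (in normed_space) mcomplete_iff:
  "Metric_space.mcomplete (vcarrier V) (vdist V) \<longleftrightarrow>
    (\<forall>\<sigma> :: nat \<Rightarrow> 'v. range \<sigma> \<subseteq> vcarrier V \<longrightarrow>
      (\<forall>e>0. \<exists>N. \<forall>m\<ge>N. \<forall>n\<ge>N. vnorm V (vadd V (\<sigma> m) (vscale V (-1) (\<sigma> n))) < e) \<longrightarrow>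
      (\<exists>x\<in>vcarrier V. \<forall>e>0. \<exists>N. \<forall>n\<ge>N. vnorm V (vadd V (\<sigma> n) (vscale V (-1) x)) < e))"
    (is "_ \<longleftrightarrow> (\<forall>\<sigma>. ?R \<sigma> \<longrightarrow> ?C \<sigma> \<longrightarrow> ?L \<sigma>)")
proof -
  interpret M: Metric_space "vcarrier V" "vdist V" by (rule vdist_metric)
  have C: "M.MCauchy \<sigma> \<longleftrightarrow> ?R \<sigma> \<and> ?C \<sigma>" for \<sigma>
    unfolding M.MCauchy_def by (rule conj_cong[OF refl]) (auto simp: vdist_def image_subset_iff)
  have L: "(\<exists>x. limitin M.mtopology \<sigma> x sequentially) \<longleftrightarrow> ?L \<sigma>" if "?R \<sigma>" for \<sigma>
  proof -
    have "\<sigma> n \<in> vcarrier V" for n using that by auto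
    then show ?thesis
      by (auto simp: M.limitin_metric eventually_sequentially vdist_def)
  qed
  show ?thesis
  proof
    assume "M.mcomplete"
    show "\<forall>\<sigma>. ?R \<sigma> \<longrightarrow> ?C \<sigma> \<longrightarrow> ?L \<sigma>"
    proof (intro allI impI)
      fix \<sigma> assume R: "?R \<sigma>" and "?C \<sigma>"
      then have "M.MCauchy \<sigma>" by (simp only: C simp_thms)
      with \<open>M.mcomplete\<close> have "\<exists>x. limitin M.mtopology \<sigma> x sequentially"
        unfolding M.mcomplete_def by blast
      then show "?L \<sigma>" by (rule L[OF R, THEN iffD1])
    qed
  next
    assume R: "\<forall>\<sigma>. ?R \<sigma> \<longrightarrow> ?C \<sigma> \<longrightarrow> ?L \<sigma>"
    show "M.mcomplete"
      unfolding M.mcomplete_def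
    proof (intro allI impI)
      fix \<sigma> assume "M.MCauchy \<sigma>"
      then have "?R \<sigma>" and "?C \<sigma>"
        by (rule C[THEN iffD1, THEN conjunct1], rule C[THEN iffD1, THEN conjunct2])
      then have "?L \<sigma>" by (rule R[THEN spec, THEN mp, THEN mp])
      then show "\<exists>x. limitin M.mtopology \<sigma> x sequentially"
        by (rule L[OF \<open>?R \<sigma>\<close>, THEN iffD2])
    qed
  qed
qed

definition bounded_operator ::
  "'v normed_structure \<Rightarrow> 'w normed_structure \<Rightarrow> ('v \<Rightarrow> 'w) \<Rightarrow> bool" where
  "bounded_operator V W T \<longleftrightarrow>
    (\<forall>x\<in>vcarrier V. T x \<in> vcarrier W) \<and>
    (\<forall>x\<in>vcarrier V. \<forall>y\<in>vcarrier V. T (vadd V x y) = vadd W (T x) (T y)) \<and>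
    (\<forall>a. \<forall>x\<in>vcarrier V. T (vscale V a x) = vscale W a (T x)) \<and>
    (\<exists>B. \<forall>x\<in>vcarrier V. vnorm W (T x) \<le> B * vnorm V x)"


section \<open>Twisted sums\<close>

definition twisted_sum ::
  "'z normed_structure \<Rightarrow> 'x normed_structure \<Rightarrow> 'y normed_structure \<Rightarrow>
    ('z \<Rightarrow> 'x) \<Rightarrow> ('x \<Rightarrow> 'y) \<Rightarrow> bool" where
  "twisted_sum Z X Y i q \<longleftrightarrow>
    banach_space Z \<and> banach_space X \<and> banach_space Y \<and>
    bounded_operator Z X i \<and> bounded_operator X Y q \<and>
    inj_on i (vcarrier Z) \<and>
    i ` vcarrier Z = {x \<in> vcarrier X. q x = vzero Y} \<and>
    q ` vcarrier X = vcarrier Y"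

definition trivial_twisted_sum ::
  "'z normed_structure \<Rightarrow> 'x normed_structure \<Rightarrow> ('z \<Rightarrow> 'x) \<Rightarrow> bool" where
  "trivial_twisted_sum Z X i \<longleftrightarrow>
    (\<exists>r. bounded_operator X Z r \<and> (\<forall>z\<in>vcarrier Z. r (i z) = z))"

text \<open>
  HOL cannot quantify existentially over the carrier type of the middle space \<open>X\<close>. This is no
  restriction: as a set, \<open>X\<close> is in bijection with the product of the carriers of \<open>Z\<close> and \<open>Y\<close>, so up
  to isomorphism every twisted sum of \<open>Z\<close> and \<open>Y\<close> lives on the product type; this is lemma
  \<open>ex_nontrivial_twisted_sumI\<close> below.
\<close>

definition ex_nontrivial_twisted_sum ::
  "'z normed_structure \<Rightarrow> 'y normed_structure \<Rightarrow> bool" where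
  "ex_nontrivial_twisted_sum Z Y \<longleftrightarrow>
    (\<exists>(X :: ('z \<times> 'y) normed_structure) i q.
      twisted_sum Z X Y i q \<and> \<not> trivial_twisted_sum Z X i)"

lemma ex_nontrivial_twisted_sumI:
  fixes Z :: "'z normed_structure" and X :: "'x normed_structure" and Y :: "'y normed_structure"
  assumes ts: "twisted_sum Z X Y i q" and nontriv: "\<not> trivial_twisted_sum Z X i"
  shows "ex_nontrivial_twisted_sum Z Y"
proof -
  interpret Z: banach_space Z using ts by (simp add: twisted_sum_def)
  interpret X: banach_space X using ts by (simp add: twisted_sum_def)
  interpret Y: banach_space Y using ts by (simp add: twisted_sum_def)
  have i: "bounded_operator Z X i" and q: "bounded_operator X Y q"
    and inj: "inj_on i (vcarrier Z)"
    and ker: "i ` vcarrier Z = {x \<in> vcarrier X. q x = vzero Y}"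
    and surj: "q ` vcarrier X = vcarrier Y"
    using ts by (auto simp: twisted_sum_def)
  have iX: "i z \<in> vcarrier X" if "z \<in> vcarrier Z" for z
    using i that by (simp add: bounded_operator_def)
  have qY: "q x \<in> vcarrier Y" if "x \<in> vcarrier X" for x
    using q that by (simp add: bounded_operator_def)
  have q_diff: "q (vadd X x (vscale X (-1) y)) = vadd Y (q x) (vscale Y (-1) (q y))"
    if "x \<in> vcarrier X" "y \<in> vcarrier X" for x y
    using q that X.scale_closed by (simp add: bounded_operator_def)
  define s where "s = inv_into (vcarrier X) q"
  have s: "s y \<in> vcarrier X" "q (s y) = y" if "y \<in> vcarrier Y" for y
    using that surj by (auto simp: s_def inv_into_into f_inv_into_f)
  define \<psi> where
    "\<psi> x = (inv_into (vcarrier Z) i (vadd X x (vscale X (-1) (s (q x)))), q x)" for x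
  have cancel: "vadd X (vadd X x (vscale X (-1) y)) y = x"
    if "x \<in> vcarrier X" "y \<in> vcarrier X" for x y
    using that
    by (metis X.add_assoc X.add_commute X.add_inverse X.add_zero X.scale_closed X.zero_closed)
  have inj_psi: "inj_on \<psi> (vcarrier X)"
  proof
    fix x y assume x: "x \<in> vcarrier X" and y: "y \<in> vcarrier X" and eq: "\<psi> x = \<psi> y"
    have in_ran: "vadd X x (vscale X (-1) (s (q x))) \<in> i ` vcarrier Z" if "x \<in> vcarrier X" for x
      using that s[OF qY[OF that]] unfolding ker
      by (auto simp: q_diff Y.add_inverse qY X.add_closed X.scale_closed)
    from eq have "vadd X x (vscale X (-1) (s (q x))) = vadd X y (vscale X (-1) (s (q y)))"
      using in_ran[OF x] in_ran[OF y] by (auto simp: \<psi>_def dest: inv_into_injective)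
    then show "x = y"
      using cancel x y eq s qY by (metis Pair_inject \<psi>_def)
  qed
  define \<phi> where "\<phi> = inv_into (vcarrier X) \<psi>"
  have \<phi>\<psi>: "\<phi> (\<psi> x) = x" if "x \<in> vcarrier X" for x
    using that inj_psi by (simp add: \<phi>_def)
  define X' where "X' = \<lparr>vcarrier = \<psi> ` vcarrier X, vzero = \<psi> (vzero X),
    vadd = (\<lambda>u v. \<psi> (vadd X (\<phi> u) (\<phi> v))), vscale = (\<lambda>a u. \<psi> (vscale X a (\<phi> u))),
    vnorm = (\<lambda>u. vnorm X (\<phi> u))\<rparr>"
  have X'_simps [simp]: "vcarrier X' = \<psi> ` vcarrier X" "vzero X' = \<psi> (vzero X)"
    "vadd X' u v = \<psi> (vadd X (\<phi> u) (\<phi> v))" "vscale X' a u = \<psi> (vscale X a (\<phi> u))"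
    "vnorm X' u = vnorm X (\<phi> u)" for u v a
    by (simp_all add: X'_def)
  have psi_eq: "\<psi> x = \<psi> y \<longleftrightarrow> x = y" if "x \<in> vcarrier X" "y \<in> vcarrier X" for x y
    using that inj_psi by (simp add: inj_on_eq_iff)
  interpret X': normed_space X'
    by standard
      (auto simp: \<phi>\<psi> psi_eq X.zero_closed X.add_closed X.scale_closed X.add_assoc X.add_zero
        X.add_inverse X.scale_add_right X.scale_add_left X.scale_scale X.scale_one
        X.norm_eq_zero X.norm_scale X.norm_triangle intro: X.add_commute)
  have "Metric_space.mcomplete (vcarrier X') (vdist X')"
    unfolding X'.mcomplete_iff
  proof (intro allI impI)
    fix \<sigma> :: "nat \<Rightarrow> 'z \<times> 'y"
    assume ran: "range \<sigma> \<subseteq> vcarrier X'"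
      and cau: "\<forall>e>0. \<exists>N. \<forall>m\<ge>N. \<forall>n\<ge>N. vnorm X' (vadd X' (\<sigma> m) (vscale X' (-1) (\<sigma> n))) < e"
    have \<sigma>: "\<phi> (\<sigma> n) \<in> vcarrier X" "\<psi> (\<phi> (\<sigma> n)) = \<sigma> n" for n
    proof -
      obtain x where "x \<in> vcarrier X" "\<sigma> n = \<psi> x" using ran by (auto simp: image_subset_iff)
      then show "\<phi> (\<sigma> n) \<in> vcarrier X" "\<psi> (\<phi> (\<sigma> n)) = \<sigma> n" by (simp_all add: \<phi>\<psi>)
    qed
    have "\<forall>e>0. \<exists>N. \<forall>m\<ge>N. \<forall>n\<ge>N.
        vnorm X (vadd X (\<phi> (\<sigma> m)) (vscale X (-1) (\<phi> (\<sigma> n)))) < e"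
      using cau by (simp add: \<sigma> \<phi>\<psi> X.add_closed X.scale_closed)
    moreover have "range (\<lambda>n. \<phi> (\<sigma> n)) \<subseteq> vcarrier X" using \<sigma> by auto
    ultimately have "\<exists>x\<in>vcarrier X. \<forall>e>0. \<exists>N. \<forall>n\<ge>N.
        vnorm X (vadd X (\<phi> (\<sigma> n)) (vscale X (-1) x)) < e"
      by (intro X.complete[unfolded X.mcomplete_iff, THEN spec, THEN mp, THEN mp])
    then obtain x where x: "x \<in> vcarrier X"
      and lim: "\<forall>e>0. \<exists>N. \<forall>n\<ge>N. vnorm X (vadd X (\<phi> (\<sigma> n)) (vscale X (-1) x)) < e"
      by blast
    then show "\<exists>x\<in>vcarrier X'. \<forall>e>0. \<exists>N. \<forall>n\<ge>N.
        vnorm X' (vadd X' (\<sigma> n) (vscale X' (-1) x)) < e"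
      by (intro bexI[of _ "\<psi> x"]) (simp_all add: \<sigma> \<phi>\<psi> X.add_closed X.scale_closed)
  qed
  then have "banach_space X'" by unfold_locales
  moreover have "bounded_operator Z X' (\<psi> \<circ> i)"
    using i by (auto simp: bounded_operator_def \<phi>\<psi>)
  moreover have "bounded_operator X' Y (q \<circ> \<phi>)"
    using q by (auto simp: bounded_operator_def \<phi>\<psi> X.add_closed X.scale_closed)
  moreover have "inj_on (\<psi> \<circ> i) (vcarrier Z)"
    using inj inj_psi iX by (auto simp: inj_on_def)
  moreover have "(\<psi> \<circ> i) ` vcarrier Z = {u \<in> vcarrier X'. (q \<circ> \<phi>) u = vzero Y}"
    unfolding image_comp[symmetric] ker by (auto simp: \<phi>\<psi>)
  moreover have "(q \<circ> \<phi>) ` vcarrier X' = vcarrier Y"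
    unfolding surj[symmetric] by (force simp: \<phi>\<psi> image_iff)
  ultimately have ts': "twisted_sum Z X' Y (\<psi> \<circ> i) (q \<circ> \<phi>)"
    using Z.banach_space_axioms Y.banach_space_axioms by (simp add: twisted_sum_def)
  have "\<not> trivial_twisted_sum Z X' (\<psi> \<circ> i)"
  proof
    assume "trivial_twisted_sum Z X' (\<psi> \<circ> i)"
    then obtain r where r: "bounded_operator X' Z r" "\<forall>z\<in>vcarrier Z. r (\<psi> (i z)) = z"
      by (auto simp: trivial_twisted_sum_def)
    have "bounded_operator X Z (r \<circ> \<psi>)"
      using r(1) by (auto simp: bounded_operator_def \<phi>\<psi>)
    with r(2) nontriv show False
      by (auto simp: trivial_twisted_sum_def)
  qed
  with ts' show ?thesis unfolding ex_nontrivial_twisted_sum_def by blast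
qed


section \<open>The spaces $c_0$ and $C(K)$\<close>

text \<open>
  A space \<open>A\<close> of bounded functions on \<open>S\<close>, extensional outside \<open>S\<close>, with pointwise operations and the
  supremum norm; inserting \<open>0\<close> only matters when \<open>S\<close> is empty.
\<close>

definition sup_normed :: "'a set \<Rightarrow> ('a \<Rightarrow> real) set \<Rightarrow> ('a \<Rightarrow> real) normed_structure" where
  "sup_normed S A = \<lparr>vcarrier = A,
    vzero = (\<lambda>x\<in>S. 0),
    vadd = (\<lambda>f g. \<lambda>x\<in>S. f x + g x),
    vscale = (\<lambda>a f. \<lambda>x\<in>S. a * f x),
    vnorm = (\<lambda>f. Sup (insert 0 ((\<lambda>x. \<bar>f x\<bar>) ` S)))\<rparr>"

definition c0_space :: "(nat \<Rightarrow> real) normed_structure" where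
  "c0_space = sup_normed UNIV {f. f \<longlonglongrightarrow> 0}"

definition C_space :: "'a topology \<Rightarrow> ('a \<Rightarrow> real) normed_structure" where
  "C_space K = sup_normed (topspace K)
    {f \<in> extensional (topspace K). continuous_map K euclideanreal f}"

lemma banach_space_sup_normed:
  assumes ext: "A \<subseteq> extensional S"
    and bdd: "\<And>f. f \<in> A \<Longrightarrow> \<exists>B. \<forall>x\<in>S. \<bar>f x\<bar> \<le> B"
    and zero: "(\<lambda>x\<in>S. 0) \<in> A"
    and add: "\<And>f g. \<lbrakk>f \<in> A; g \<in> A\<rbrakk> \<Longrightarrow> (\<lambda>x\<in>S. f x + g x) \<in> A"
    and scale: "\<And>a f. f \<in> A \<Longrightarrow> (\<lambda>x\<in>S. a * f x) \<in> A"
    and lim: "\<And>\<sigma> f. \<lbrakk>\<And>n. \<sigma> n \<in> A; f \<in> extensional S; uniform_limit S \<sigma> f sequentially\<rbrakk> \<Longrightarrow> f \<in> A"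
  shows "banach_space (sup_normed S A)"
proof -
  define N where "N f = Sup (insert 0 ((\<lambda>x. \<bar>f x\<bar>) ` S))" for f :: "'a \<Rightarrow> real"
  have [simp]: "vcarrier (sup_normed S A) = A" "vzero (sup_normed S A) = (\<lambda>x\<in>S. 0)"
    "vadd (sup_normed S A) f g = (\<lambda>x\<in>S. f x + g x)"
    "vscale (sup_normed S A) a f = (\<lambda>x\<in>S. a * f x)"
    "vnorm (sup_normed S A) f = N f" for a f g
    by (simp_all add: sup_normed_def N_def)
  have bddN: "bdd_above (insert 0 ((\<lambda>x. \<bar>f x\<bar>) ` S))" if "f \<in> A" for f
    using bdd[OF that] by (metis bdd_aboveI2 bdd_above_insert)
  have N_ge: "\<bar>f x\<bar> \<le> N f" if "f \<in> A" "x \<in> S" for f x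
    unfolding N_def using that bddN[OF that(1)] by (intro cSup_upper) auto
  have N_ge0: "0 \<le> N f" if "f \<in> A" for f
    unfolding N_def using bddN[OF that] by (intro cSup_upper) auto
  have N_le: "N f \<le> B" if "0 \<le> B" "\<And>x. x \<in> S \<Longrightarrow> \<bar>f x\<bar> \<le> B" for f B
    unfolding N_def using that by (intro cSup_least) auto
  have eqI: "f = g" if "f \<in> A" "g \<in> A" "\<And>x. x \<in> S \<Longrightarrow> f x = g x" for f g
    using that ext by (meson extensionalityI subsetD)
  have extS: "f \<in> extensional S" if "f \<in> A" for f
    using that ext by blast
  have N_scale_le: "N (\<lambda>x\<in>S. a * f x) \<le> \<bar>a\<bar> * N f" if "f \<in> A" for a f
    using that by (intro N_le) (auto simp: N_ge0 abs_mult intro: mult_left_mono N_ge)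
  interpret normed_space "sup_normed S A"
  proof
    fix f g h :: "'a \<Rightarrow> real" and a b :: real
    show "f \<in> vcarrier (sup_normed S A) \<Longrightarrow>
      (vnorm (sup_normed S A) f = 0) = (f = vzero (sup_normed S A))"
    proof
      assume f: "f \<in> vcarrier (sup_normed S A)" and "vnorm (sup_normed S A) f = 0"
      then have "f x = 0" if "x \<in> S" for x using N_ge[of f x] that by simp
      then show "f = vzero (sup_normed S A)" using f zero by (auto intro: eqI)
    next
      assume f: "f \<in> vcarrier (sup_normed S A)" and "f = vzero (sup_normed S A)"
      then have "N f \<le> 0" by (intro N_le) auto
      with N_ge0[of f] f show "vnorm (sup_normed S A) f = 0" by simp
    qed
    show "f \<in> vcarrier (sup_normed S A) \<Longrightarrow> vnorm (sup_normed S A) (vscale (sup_normed S A) a f) =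
      \<bar>a\<bar> * vnorm (sup_normed S A) f"
    proof (cases "a = 0")
      case True
      assume "f \<in> vcarrier (sup_normed S A)"
      with True N_scale_le[of f 0] N_ge0[OF scale, of f 0] show ?thesis by simp
    next
      case False
      assume "f \<in> vcarrier (sup_normed S A)"
      then have f: "f \<in> A" by simp
      have "(\<lambda>x\<in>S. inverse a * (\<lambda>x\<in>S. a * f x) x) = f"
        using False f by (intro eqI scale) auto
      with N_scale_le[OF scale[OF f, of a], of "inverse a"] have "N f \<le> \<bar>inverse a\<bar> * N (\<lambda>x\<in>S. a * f x)"
        by simp
      with False have "\<bar>a\<bar> * N f \<le> N (\<lambda>x\<in>S. a * f x)"
        by (simp add: field_simps)
      with N_scale_le[OF f, of a] show ?thesis by simp
    qed
    show "\<lbrakk>f \<in> vcarrier (sup_normed S A); g \<in> vcarrier (sup_normed S A)\<rbrakk> \<Longrightarrow>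
      vnorm (sup_normed S A) (vadd (sup_normed S A) f g) \<le>
      vnorm (sup_normed S A) f + vnorm (sup_normed S A) g"
      by (auto intro!: N_le simp: N_ge0) (meson N_ge abs_triangle_ineq add_mono order_trans)
  qed (simp_all add: zero add scale,
       (rule extensionalityI[of _ S]; use extS in \<open>simp add: algebra_simps\<close>)+)
  have "Metric_space.mcomplete (vcarrier (sup_normed S A)) (vdist (sup_normed S A))"
    unfolding mcomplete_iff
  proof (intro allI impI)
    fix \<sigma> :: "nat \<Rightarrow> 'a \<Rightarrow> real"
    assume ran: "range \<sigma> \<subseteq> vcarrier (sup_normed S A)"
      and cau: "\<forall>e>0. \<exists>M. \<forall>m\<ge>M. \<forall>n\<ge>M. vnorm (sup_normed S A)
        (vadd (sup_normed S A) (\<sigma> m) (vscale (sup_normed S A) (-1) (\<sigma> n))) < e"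
    have \<sigma>: "\<sigma> n \<in> A" for n using ran by auto
    have diff: "\<bar>f x - g x\<bar> \<le> N (\<lambda>x\<in>S. f x + (\<lambda>x\<in>S. -1 * g x) x)"
      if "f \<in> A" "g \<in> A" "x \<in> S" for f g x
      using N_ge[OF add[OF that(1) scale[OF that(2), of "-1"]] that(3)] that(3) by simp
    have "uniformly_convergent_on S \<sigma>"
    proof (rule Cauchy_uniformly_convergent, unfold uniformly_Cauchy_on_def, intro allI impI)
      fix e :: real assume "e > 0"
      with cau obtain M where M: "\<forall>m\<ge>M. \<forall>n\<ge>M. N (\<lambda>x\<in>S. \<sigma> m x + (\<lambda>x\<in>S. -1 * \<sigma> n x) x) < e"
        by auto
      have "dist (\<sigma> m x) (\<sigma> n x) < e" if "x \<in> S" "m \<ge> M" "n \<ge> M" for x m n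
        unfolding dist_real_def
        by (rule le_less_trans[OF diff[OF \<sigma> \<sigma> that(1)] M[THEN spec, THEN mp, THEN spec, THEN mp]])
          (fact that)+
      then show "\<exists>M. \<forall>x\<in>S. \<forall>m\<ge>M. \<forall>n\<ge>M. dist (\<sigma> m x) (\<sigma> n x) < e"
        by blast
    qed
    then obtain g where g: "uniform_limit S \<sigma> g sequentially"
      by (auto simp: uniformly_convergent_on_def)
    define f where "f = restrict g S"
    have ul: "uniform_limit S \<sigma> f sequentially"
      using g by (subst uniform_limit_cong'[of S \<sigma> \<sigma> f g]) (auto simp: f_def)
    have f: "f \<in> A" by (rule lim[OF \<sigma> _ ul]) (simp add: f_def)
    show "\<exists>x\<in>vcarrier (sup_normed S A). \<forall>e>0. \<exists>M. \<forall>n\<ge>M. vnorm (sup_normed S A)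
        (vadd (sup_normed S A) (\<sigma> n) (vscale (sup_normed S A) (-1) x)) < e"
    proof (intro bexI[of _ f] allI impI)
      fix e :: real assume "e > 0"
      then obtain M where M: "\<And>n x. \<lbrakk>n \<ge> M; x \<in> S\<rbrakk> \<Longrightarrow> dist (\<sigma> n x) (f x) < e / 2"
        using uniform_limitD[OF ul, of "e / 2"] by (auto simp: eventually_sequentially)
      have "N (\<lambda>x\<in>S. \<sigma> n x + (\<lambda>x\<in>S. -1 * f x) x) \<le> e / 2" if "n \<ge> M" for n
      proof (rule N_le)
        show "0 \<le> e / 2" using \<open>e > 0\<close> by simp
        show "\<bar>(\<lambda>x\<in>S. \<sigma> n x + (\<lambda>x\<in>S. -1 * f x) x) x\<bar> \<le> e / 2" if "x \<in> S" for x
          using M[OF \<open>n \<ge> M\<close> that] that by (simp add: dist_real_def)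
      qed
      moreover have "e / 2 < e" using \<open>e > 0\<close> by simp
      ultimately have "N (\<lambda>x\<in>S. \<sigma> n x + (\<lambda>x\<in>S. -1 * f x) x) < e" if "n \<ge> M" for n
        using that by (metis le_less_trans)
      then show "\<exists>M. \<forall>n\<ge>M. vnorm (sup_normed S A)
          (vadd (sup_normed S A) (\<sigma> n) (vscale (sup_normed S A) (-1) f)) < e"
        by auto
    qed (simp add: f)
  qed
  then show ?thesis by unfold_locales
qed

lemma banach_space_c0: "banach_space c0_space"
  unfolding c0_space_def
proof (rule banach_space_sup_normed)
  show "\<exists>B. \<forall>x\<in>UNIV. \<bar>f x\<bar> \<le> B" if "f \<in> {f. f \<longlonglongrightarrow> 0}" for f :: "nat \<Rightarrow> real"
    using that convergent_imp_Bseq[of f] by (auto simp: convergent_def Bseq_def)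
  show "f \<in> {f. f \<longlonglongrightarrow> 0}"
    if "\<And>n. \<sigma> n \<in> {f. f \<longlonglongrightarrow> 0}" "uniform_limit UNIV \<sigma> f sequentially"
    for \<sigma> and f :: "nat \<Rightarrow> real"
    using swap_uniform_limit'[of \<sigma> "\<lambda>_. 0" sequentially sequentially 0 UNIV f] that
    by simp
qed (auto simp: restrict_def intro: tendsto_add_zero tendsto_mult_right_zero)

lemma banach_space_C:
  assumes "compact_space K"
  shows "banach_space (C_space K)"
  unfolding C_space_def
proof (rule banach_space_sup_normed)
  let ?A = "{f \<in> extensional (topspace K). continuous_map K euclideanreal f}"
  show "\<exists>B. \<forall>x\<in>topspace K. \<bar>f x\<bar> \<le> B" if "f \<in> ?A" for f
  proof -
    have "compact (f ` topspace K)"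
      using assms that image_compactin[of K "topspace K" euclideanreal f]
      by (simp add: compact_space_def)
    then show ?thesis using compact_imp_bounded bounded_iff by (metis image_eqI real_norm_def)
  qed
  show "f \<in> ?A" if "\<And>n. \<sigma> n \<in> ?A" "f \<in> extensional (topspace K)"
    "uniform_limit (topspace K) \<sigma> f sequentially" for \<sigma> f
  proof -
    have "continuous_map K Met_TC.mtopology f"
    proof (rule Met_TC.continuous_map_uniform_limit[where F = sequentially and f = \<sigma>])
      show "\<forall>\<^sub>F n in sequentially. continuous_map K Met_TC.mtopology (\<sigma> n)"
        using that(1) by simp
      show "\<forall>\<^sub>F n in sequentially. \<forall>x\<in>topspace K. f x \<in> UNIV \<and> dist (\<sigma> n x) (f x) < e"
        if "0 < e" for e
        using uniform_limitD[OF \<open>uniform_limit _ _ _ _\<close> that] by simp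
    qed auto
    with that show ?thesis by simp
  qed
qed (auto simp: continuous_map_add continuous_map_real_mult)


section \<open>Dyadic spaces and the continuum hypothesis\<close>

definition cantor_cube :: "'i set \<Rightarrow> ('i \<Rightarrow> bool) topology" where
  "cantor_cube I = product_topology (\<lambda>_. discrete_topology UNIV) I"

text \<open>
  The exponents of the cubes range over all subsets of the type \<open>'i\<close>; since \<open>'i\<close> is a type variable,
  a theorem with the premise \<open>dyadic_space TYPE('i) K\<close> covers all exponents.
\<close>

definition dyadic_space :: "'i itself \<Rightarrow> 'a topology \<Rightarrow> bool" where
  "dyadic_space _ K \<longleftrightarrow> compact_space K \<and> Hausdorff_space K \<and>
    (\<exists>(I :: 'i set) f. continuous_map (cantor_cube I) K f \<and>
      f ` topspace (cantor_cube I) = topspace K)"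

definition continuum_hypothesis :: bool where
  "continuum_hypothesis \<longleftrightarrow> (card_of (UNIV :: nat set set), cardSuc natLeq) \<in> ordIso"

end

theory Submission
  imports Defs
begin

text \<open>
  Operators $T : C(K) \to \ell_\infty/c_0$ produce twisted sums of $c_0$ and $C(K)$ by pulling back
  the quotient map $\ell_\infty \to \ell_\infty/c_0$, and the twisted sum is trivial exactly when $T$
  lifts to a bounded operator $U : C(K) \to \ell_\infty$. The task is to find an operator without a lift.

  Let $(A_t)$ be an almost disjoint family of infinite sets of natural numbers, and let $(p_t, q_t)$
  be pairs of points of $K$ and $w_t$ weights in $[-1,1]$ such that $(w_t (f(p_t) - f(q_t)))_t$ is in
  $c_0$ for every $f \in C(K)$. Then $T f = \sum_t w_t (f(p_t) - f(q_t)) \chi_{A_t}$ is such an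
  operator $T$ (locale \<open>almost_disjoint_jumps\<close>).

  Suppose that there are disjoint open sets $V_0, V_1, \dots$ in $K$ and that each $V_i$ supplies its
  own family of pairs of distinct points $p_{i,t} \in V_i$ and $q_{i,t} \in K$ with
  $(f(p_{i,t}) - f(q_{i,t}))_t$ in $c_0$ for all $f \in C(K)$, indexed by all subsets $t$ of
  $\nat \times \nat$. For each $t$ one index $c(t)$ is chosen, and the pair
  $(p_{c(t),t}, q_{c(t),t})$ with weight $1/(c(t)+1)$ is attached to $A_t$.
  A lift $U$ of $T$ leaves a trace, the set $E$ of all $(i,n)$ for which some $f$ in the unit ball of
  $C(K)$, vanishing off $V_i$, satisfies $U f(n) > 1/(2(i+1))$. For fixed $n$ such functions can be
  added without leaving the unit ball since the $V_i$ are disjoint, and the harmonic series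
  diverges; so for some $m$ there is no $n$ with $(i,n) \in E$ for all $i < m$. Hence, for some fixed
  $i$, infinitely many $n \in A_E$ have $(i,n) \notin E$. If $c(E)$ is such an $i$, then a function
  in the unit ball that is supported by $V_i$ and takes the values $1$ at $p_{i,E}$ and $0$ at
  $q_{i,E}$ contradicts the fact that $U$ lifts $T$. As all traces are subsets of
  $\nat \times \nat$, this diagonal choice of $c$ defeats all lifts simultaneously
  (\<open>nontrivial_twisted_sum_of_localized_jumps\<close>).

  In a dyadic space $K = \varphi[2^I]$ the pairs come from flipping one coordinate: if
  $p_t = \varphi(x_t)$ and $q_t = \varphi(y_t)$, where $x_t$ and $y_t$ differ at a single coordinate and
  these coordinates are distinct for different $t$, then $f(p_t) - f(q_t)$ tends to $0$, because
  $f \circ \varphi$ depends on finitely many coordinates up to $\varepsilon$. If only countably many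
  coordinates matter for $\varphi$, then $K$ is metrizable. Otherwise the points of $K$ all of whose
  neighbourhoods see uncountably many coordinates form an infinite set
  (\<open>infinite_heavy\<close>, a consequence of the countable chain condition of $2^I$), which yields
  the sets $V_i$. The continuum hypothesis enters only to index the
  uncountably many coordinates seen by $V_i$ by all subsets of $\nat \times \nat$.
\<close>

section \<open>Cylinders in Cantor cubes\<close>

definition cylinder :: "'i set \<Rightarrow> 'i set \<Rightarrow> ('i \<Rightarrow> bool) \<Rightarrow> ('i \<Rightarrow> bool) set" where
  "cylinder I a x = {y \<in> extensional I. \<forall>i\<in>a. y i = x i}"

lemma topspace_cantor_cube: "topspace (cantor_cube I) = extensional I"
  by (simp add: cantor_cube_def PiE_UNIV_domain PiE_def Pi_UNIV)

lemma compact_space_cantor_cube: "compact_space (cantor_cube I)"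
  by (simp add: cantor_cube_def compact_space_product_topology compact_space_discrete_topology)

lemma cylinder_eq_PiE: "a \<subseteq> I \<Longrightarrow> cylinder I a x = PiE I (\<lambda>i. if i \<in> a then {x i} else UNIV)"
  by (auto simp: cylinder_def PiE_def Pi_def split: if_splits)

lemma openin_cylinder: "finite a \<Longrightarrow> a \<subseteq> I \<Longrightarrow> openin (cantor_cube I) (cylinder I a x)"
  unfolding cylinder_eq_PiE cantor_cube_def
  by (intro openin_PiE_gen[THEN iffD2] disjI2 conjI) (auto elim: rev_finite_subset)

lemma closedin_cylinder: "a \<subseteq> I \<Longrightarrow> closedin (cantor_cube I) (cylinder I a x)"
  unfolding cylinder_eq_PiE cantor_cube_def closedin_product_topology by auto

lemma cylinder_nbhd:
  assumes "openin (cantor_cube I) W" "x \<in> W"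
  obtains a where "finite a" "a \<subseteq> I" "cylinder I a x \<subseteq> W"
proof -
  obtain U where U: "finite {i \<in> I. U i \<noteq> UNIV}" "x \<in> PiE I U" "PiE I U \<subseteq> W"
    using assms unfolding cantor_cube_def openin_product_topology_alt by auto
  have "cylinder I {i \<in> I. U i \<noteq> UNIV} x \<subseteq> PiE I U"
  proof
    fix y assume y: "y \<in> cylinder I {i \<in> I. U i \<noteq> UNIV} x"
    have "y i \<in> U i" if "i \<in> I" for i
      using y U(2) that by (cases "U i = UNIV") (auto simp: cylinder_def PiE_def Pi_def)
    then show "y \<in> PiE I U" using y by (auto simp: cylinder_def PiE_def)
  qed
  then show ?thesis using U that[of "{i \<in> I. U i \<noteq> UNIV}"] by blast
qed

text \<open>
  Think of \<open>x j\<close> restricted to \<open>a j\<close> as a finite partial function. The induction is on the size of the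
  domains: a partial function compatible with only countably many of the others disagrees with
  uncountably many of them, and then uncountably many share one value at one point of its domain. That
  point can be removed from their domains without affecting compatibility.
\<close>

lemma uncountable_compatible_bounded:
  assumes "uncountable X" "\<And>j. j \<in> X \<Longrightarrow> finite (a j) \<and> card (a j) \<le> n"
  shows "\<exists>j\<in>X. uncountable {k \<in> X. \<forall>i\<in>a j \<inter> a k. x j i = (x k i :: bool)}"
  using assms
proof (induction n arbitrary: X a)
  case 0
  have "a j = {}" if "j \<in> X" for j using 0(2)[OF that] by (metis card_0_eq le_zero_eq)
  then have "{k \<in> X. \<forall>i\<in>a j \<inter> a k. x j i = x k i} = X" if "j \<in> X" for j using that by auto
  moreover have "X \<noteq> {}" using 0(1) by auto
  ultimately show ?case using 0(1) by auto
next
  case (Suc n)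
  obtain j where j: "j \<in> X" using Suc.prems(1) by fastforce
  let ?C = "{k \<in> X. \<forall>i\<in>a j \<inter> a k. x j i = x k i}"
  let ?Z = "\<lambda>i. {k \<in> X. i \<in> a k \<and> x k i \<noteq> x j i}"
  show ?case
  proof (cases "uncountable ?C")
    case True
    with j show ?thesis by blast
  next
    case False
    have "X \<subseteq> ?C \<union> (\<Union>i\<in>a j. ?Z i)" by auto
    moreover have "finite (a j)" using Suc.prems(2) j by blast
    ultimately obtain i where "i \<in> a j" and Z: "uncountable (?Z i)"
      using False Suc.prems(1)
      by (metis (no_types, lifting) countable_UN countable_Un countable_finite countable_subset)
    have "\<exists>k\<in>?Z i. uncountable {l \<in> ?Z i. \<forall>i'\<in>(a k - {i}) \<inter> (a l - {i}). x k i' = x l i'}"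
    proof (rule Suc.IH[OF Z])
      fix k assume "k \<in> ?Z i"
      then show "finite (a k - {i}) \<and> card (a k - {i}) \<le> n"
        using Suc.prems(2)[of k] by (auto simp: card_Diff_singleton)
    qed
    then obtain k where k: "k \<in> ?Z i"
      and u: "uncountable {l \<in> ?Z i. \<forall>i'\<in>(a k - {i}) \<inter> (a l - {i}). x k i' = x l i'}" by blast
    have sub: "{l \<in> ?Z i. \<forall>i'\<in>(a k - {i}) \<inter> (a l - {i}). x k i' = x l i'} \<subseteq>
        {l \<in> X. \<forall>i'\<in>a k \<inter> a l. x k i' = x l i'}"
      using k by auto
    have "uncountable {l \<in> X. \<forall>i'\<in>a k \<inter> a l. x k i' = x l i'}"
      using u by (rule contrapos_nn) (rule countable_subset[OF sub])
    with k show ?thesis by (intro bexI[of _ k]) auto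
  qed
qed

text \<open>
  This strengthens the countable chain condition of Cantor cubes: among uncountably many basic
  cylinders, one meets uncountably many of them.
\<close>

lemma uncountable_compatible:
  assumes "uncountable X" and fin: "\<And>j. j \<in> X \<Longrightarrow> finite (a j)"
  obtains j where "j \<in> X" "uncountable {k \<in> X. \<forall>i\<in>a j \<inter> a k. x j i = (x k i :: bool)}"
proof -
  have "X = (\<Union>n. {j \<in> X. card (a j) \<le> n})" by auto
  then have "\<not> (\<forall>n. countable {j \<in> X. card (a j) \<le> n})"
    using assms(1) countable_UN[OF countableI_type[of UNIV], of "\<lambda>n. {j \<in> X. card (a j) \<le> n}"] by metis
  then obtain n where n: "uncountable {j \<in> X. card (a j) \<le> n}" by blast
  obtain j where j: "j \<in> X" and
    u: "uncountable {k \<in> {j \<in> X. card (a j) \<le> n}. \<forall>i\<in>a j \<inter> a k. x j i = x k i}"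
    using uncountable_compatible_bounded[OF n, of a n x] fin by auto
  have "uncountable {k \<in> X. \<forall>i\<in>a j \<inter> a k. x j i = x k i}"
    using u by (rule contrapos_nn) (erule countable_subset[rotated], auto)
  with j show ?thesis by (rule that)
qed

section \<open>Metrizability and disjoint open sets\<close>

text \<open>
  The family embeds the space into a countable power of the real line.
\<close>

lemma metrizable_of_countable_separating_family:
  assumes K: "compact_space K" and "countable F"
    and cont: "\<And>f. f \<in> F \<Longrightarrow> continuous_map K euclideanreal f"
    and sep: "\<And>p q. \<lbrakk>p \<in> topspace K; q \<in> topspace K; p \<noteq> q\<rbrakk> \<Longrightarrow> \<exists>f\<in>F. f p \<noteq> f q"
  shows "metrizable_space K"
proof -
  let ?R = "product_topology (\<lambda>f. euclideanreal) F"
  let ?e = "\<lambda>p. \<lambda>f\<in>F. f p"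
  have cont_e: "continuous_map K ?R ?e"
    unfolding continuous_map_componentwise using cont by auto
  have R: "metrizable_space ?R"
    unfolding metrizable_space_product_topology
  proof (intro disjI2 conjI ballI)
    show "countable {i \<in> F. \<not> (\<exists>a. topspace euclideanreal \<subseteq> {a})}"
      using \<open>countable F\<close> by (rule countable_subset[rotated]) simp
  qed (rule metrizable_space_euclidean)
  have "Hausdorff_space ?R" by (simp add: Hausdorff_space_product_topology)
  then have "closed_map K ?R ?e" using K cont_e by (intro continuous_imp_closed_map_gen Hausdorff_imp_kc_space)
  moreover have "inj_on ?e (topspace K)"
  proof (rule inj_onI, rule ccontr)
    fix p q assume "p \<in> topspace K" "q \<in> topspace K" "?e p = ?e q" "p \<noteq> q"
    moreover from this obtain f where "f \<in> F" "f p \<noteq> f q" using sep by blast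
    ultimately show False by (metis restrict_apply')
  qed
  ultimately have "embedding_map K ?R ?e"
    using cont_e by (intro injective_closed_imp_embedding_map)
  then have "K homeomorphic_space subtopology ?R (?e ` topspace K)"
    by (rule embedding_map_imp_homeomorphic_space)
  then show ?thesis using R metrizable_space_subtopology homeomorphic_metrizable_space by blast
qed

lemma compact_Hausdorff_separating_function:
  assumes "compact_space K" "Hausdorff_space K" "closedin K A" "closedin K B" "A \<inter> B = {}"
  obtains f where "continuous_map K euclideanreal f" "\<And>p. p \<in> topspace K \<Longrightarrow> 0 \<le> f p \<and> f p \<le> (1::real)"
    "\<And>p. p \<in> A \<Longrightarrow> f p = 0" "\<And>p. p \<in> B \<Longrightarrow> f p = 1"
proof -
  have "normal_space K" using assms compact_Hausdorff_or_regular_imp_normal_space by blast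
  then obtain f where f: "continuous_map K (top_of_set {0..1::real}) f" "f ` A \<subseteq> {0}" "f ` B \<subseteq> {1}"
    using Urysohn_lemma[of K A B 0 1] assms by (auto simp: disjnt_def)
  show ?thesis
  proof (rule that)
    show "continuous_map K euclideanreal f" using f(1) continuous_map_in_subtopology by blast
    show "0 \<le> f p \<and> f p \<le> 1" if "p \<in> topspace K" for p
      using f(1) that by (auto simp: continuous_map_in_subtopology Pi_def image_subset_iff)
  qed (use f in auto)
qed

text \<open>
  An open set containing infinitely many points of \<open>G\<close> is split into two disjoint open parts, one meeting \<open>G\<close>
  and the other still containing infinitely many points of \<open>G\<close>; the splitting is then iterated on
  the second part.
\<close>

lemma disjoint_open_sequence:
  assumes K: "regular_space K" "Hausdorff_space K" and G: "infinite G" "G \<subseteq> topspace K"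
  obtains V :: "nat \<Rightarrow> 'a set" where "\<And>i. openin K (V i)" "\<And>i. V i \<inter> G \<noteq> {}" "disjoint_family V"
proof -
  have step: "\<exists>V W'. openin K V \<and> openin K W' \<and> V \<subseteq> W \<and> W' \<subseteq> W \<and> V \<inter> W' = {} \<and> V \<inter> G \<noteq> {} \<and> infinite (W' \<inter> G)"
    if W: "openin K W" "infinite (W \<inter> G)" for W
  proof -
    obtain x where x: "x \<in> W \<inter> G" using W(2) infinite_imp_nonempty by blast
    have "infinite (W \<inter> G - {x})" using W(2) by simp
    then obtain y where y: "y \<in> W \<inter> G" "y \<noteq> x" using infinite_imp_nonempty by blast
    obtain U1 U2 where U: "openin K U1" "openin K U2" "x \<in> U1" "y \<in> U2" "U1 \<inter> U2 = {}"
      using K(2)[unfolded Hausdorff_space_def disjnt_def, rule_format, of x y] x y G(2) by blast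
    show ?thesis
    proof (cases "finite (U1 \<inter> W \<inter> G)")
      case False
      moreover have "openin K (U1 \<inter> W)" "openin K (U2 \<inter> W)" using U(1,2) W(1) by auto
      moreover have "U2 \<inter> W \<inter> G \<noteq> {}" "(U2 \<inter> W) \<inter> (U1 \<inter> W) = {}" using U y by blast+
      ultimately show ?thesis by (metis Int_lower2)
    next
      case True
      have "openin K (U1 \<inter> W)" using U W by auto
      then obtain V C where V: "openin K V" "closedin K C" "x \<in> V" "V \<subseteq> C" "C \<subseteq> U1 \<inter> W"
        using K(1)[folded neighbourhood_base_of_closedin, unfolded neighbourhood_base_of,
            rule_format, of "U1 \<inter> W" x] x U(3) by blast
      have "infinite ((W - C) \<inter> G)"
      proof
        assume "finite ((W - C) \<inter> G)"
        moreover have "W \<inter> G \<subseteq> ((W - C) \<inter> G) \<union> (U1 \<inter> W \<inter> G)" using V by auto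
        ultimately show False using True W(2) by (meson finite_Un finite_subset)
      qed
      moreover have "openin K (W - C)" using W(1) V(2) by (rule openin_diff)
      moreover have "V \<inter> (W - C) = {}" "V \<subseteq> W" "V \<inter> G \<noteq> {}" using V x by blast+
      ultimately show ?thesis using V(1) by (metis Diff_subset)
    qed
  qed
  define P where "P = (\<lambda>(n::nat) (VW :: 'a set \<times> 'a set). openin K (fst VW) \<and> openin K (snd VW) \<and> fst VW \<inter> snd VW = {} \<and>
      fst VW \<inter> G \<noteq> {} \<and> infinite (snd VW \<inter> G))"
  define Q where "Q = (\<lambda>(n::nat) (VW :: 'a set \<times> 'a set) (VW' :: 'a set \<times> 'a set). fst VW' \<subseteq> snd VW \<and> snd VW' \<subseteq> snd VW)"
  have "infinite (topspace K \<inter> G)" using G by (simp add: Int_absorb1)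
  then obtain V W where "openin K V" "openin K W" "V \<inter> W = {}" "V \<inter> G \<noteq> {}" "infinite (W \<inter> G)"
    using step[OF openin_topspace] by metis
  then have P0: "\<exists>VW. P 0 VW" by (intro exI[of _ "(V, W)"]) (simp add: P_def)
  have PS: "\<exists>VW'. P (Suc n) VW' \<and> Q n VW VW'" if "P n VW" for n VW
  proof -
    have "openin K (snd VW)" "infinite (snd VW \<inter> G)" using that by (auto simp: P_def)
    then obtain V W where "openin K V" "openin K W" "V \<subseteq> snd VW" "W \<subseteq> snd VW" "V \<inter> W = {}"
      "V \<inter> G \<noteq> {}" "infinite (W \<inter> G)" using step by metis
    then show ?thesis by (intro exI[of _ "(V, W)"]) (simp add: P_def Q_def)
  qed
  obtain s where s: "\<And>n. P n (s n)" "\<And>n. Q n (s n) (s (Suc n))"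
    using dependent_nat_choice[of P Q, OF P0 PS] by blast
  have dec: "snd (s n) \<subseteq> snd (s m)" if "m \<le> n" for m n
    using s(2) by (intro lift_Suc_antimono_le[of "\<lambda>n. snd (s n)", OF _ that]) (simp add: Q_def)
  have sub: "fst (s n) \<subseteq> snd (s m)" if mn: "m < n" for m n
  proof -
    obtain k where k: "n = Suc (m + k)" using less_imp_Suc_add[OF mn] by blast
    then show ?thesis using s(2)[of "m + k"] dec[of m "m + k"] by (auto simp: Q_def)
  qed
  have dis: "fst (s m) \<inter> fst (s n) = {}" if "m < n" for m n
    using sub[OF that] s(1)[of m] by (auto simp: P_def)
  show ?thesis
  proof (rule that[of "\<lambda>n. fst (s n)"])
    show "disjoint_family (\<lambda>n. fst (s n))"
      unfolding disjoint_family_on_def using dis by (metis inf_commute linorder_neqE_nat)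
  qed (use s(1) in \<open>auto simp: P_def\<close>)
qed

section \<open>Sensitive coordinates of a dyadic space\<close>

definition flip :: "'i \<Rightarrow> ('i \<Rightarrow> bool) \<Rightarrow> 'i \<Rightarrow> bool" where
  "flip t x = x(t := \<not> x t)"

lemma flip_flip [simp]: "flip t (flip t x) = x"
  by (simp add: flip_def)

lemma flip_extensional: "x \<in> extensional I \<Longrightarrow> t \<in> I \<Longrightarrow> flip t x \<in> extensional I"
  by (auto simp: flip_def extensional_def)

locale dyadic_map =
  fixes I :: "'i set" and K :: "'a topology" and \<phi> :: "('i \<Rightarrow> bool) \<Rightarrow> 'a"
  assumes compact_K: "compact_space K" and Hausdorff_K: "Hausdorff_space K"
    and continuous_\<phi>: "continuous_map (cantor_cube I) K \<phi>"
    and surjective_\<phi>: "\<phi> ` extensional I = topspace K"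
begin

definition sensitive :: "('i \<Rightarrow> bool) set \<Rightarrow> 'i set" where
  "sensitive W = {t \<in> I. \<exists>x\<in>W. \<phi> x \<noteq> \<phi> (flip t x)}"

definition preimage :: "'a set \<Rightarrow> ('i \<Rightarrow> bool) set" where
  "preimage V = {x \<in> extensional I. \<phi> x \<in> V}"

lemma \<phi>_in: "x \<in> extensional I \<Longrightarrow> \<phi> x \<in> topspace K"
  using surjective_\<phi> by blast

lemma cylinder_in_preimage:
  assumes "openin K V" "x \<in> extensional I" "\<phi> x \<in> V"
  obtains a where "finite a" "a \<subseteq> I" "cylinder I a x \<subseteq> preimage V"
proof -
  have "openin (cantor_cube I) {x \<in> topspace (cantor_cube I). \<phi> x \<in> V}"
    using continuous_\<phi> assms(1) by (rule openin_continuous_map_preimage)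
  then have "openin (cantor_cube I) (preimage V)"
    by (simp add: topspace_cantor_cube preimage_def)
  moreover have "x \<in> preimage V" using assms by (simp add: preimage_def)
  ultimately show ?thesis using cylinder_nbhd that by metis
qed

lemma separate:
  assumes "p \<in> topspace K" "q \<in> topspace K" "p \<noteq> q"
  obtains U V where "openin K U" "openin K V" "p \<in> U" "q \<in> V" "U \<inter> V = {}"
  using Hausdorff_K assms unfolding Hausdorff_space_def disjnt_def by meson

lemma finite_change_off_sensitive:
  assumes "finite D" "D \<subseteq> I - sensitive (extensional I)"
    and "x \<in> extensional I" "y \<in> extensional I" "{i. x i \<noteq> y i} \<subseteq> D"
  shows "\<phi> x = \<phi> y"
  using assms
proof (induction D arbitrary: x rule: finite_induct)
  case empty
  then have "x = y" by auto
  then show ?case by simp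
next
  case (insert t D)
  have t: "t \<in> I" "t \<notin> sensitive (extensional I)" using insert.prems by auto
  define z where "z = (if x t = y t then x else flip t x)"
  have "\<phi> x = \<phi> z"
    using t insert.prems by (auto simp: z_def sensitive_def)
  moreover have "\<phi> z = \<phi> y"
  proof (rule insert.IH)
    show "z \<in> extensional I" using insert.prems t by (auto simp: z_def flip_extensional)
    show "{i. z i \<noteq> y i} \<subseteq> D"
      using insert.prems by (auto simp: z_def flip_def split: if_splits)
  qed (use insert.prems in auto)
  ultimately show ?case by simp
qed

text \<open>
  By continuity, \<open>y\<close> may be replaced by a point that differs from \<open>x\<close> at only finitely many coordinates, and
  the passage between the two can then be made by successive flips.
\<close>

lemma determined_by_sensitive:
  assumes x: "x \<in> extensional I" and y: "y \<in> extensional I"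
    and agree: "\<And>i. i \<in> sensitive (extensional I) \<Longrightarrow> x i = y i"
  shows "\<phi> x = \<phi> y"
proof (rule ccontr)
  assume "\<phi> x \<noteq> \<phi> y"
  then obtain U V where UV: "openin K V" "\<phi> x \<in> U" "\<phi> y \<in> V" "U \<inter> V = {}"
    using separate[OF \<phi>_in[OF x] \<phi>_in[OF y]] by metis
  obtain a where a: "finite a" "a \<subseteq> I" "cylinder I a y \<subseteq> preimage V"
    using cylinder_in_preimage[OF UV(1) y UV(3)] .
  define z where "z i = (if i \<in> a then y i else x i)" for i
  have z: "z \<in> cylinder I a y" using x y a(2) by (auto simp: z_def cylinder_def extensional_def)
  have "\<phi> x = \<phi> z"
    using x z agree a(1,2)
    by (intro finite_change_off_sensitive[of "a - sensitive (extensional I)"])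
      (auto simp: z_def cylinder_def split: if_splits)
  moreover have "\<phi> z \<in> V" using z a(3) by (auto simp: preimage_def)
  ultimately show False using UV by auto
qed

text \<open>
  There are countably many basic cylinders over the sensitive coordinates, and since \<open>\<phi>\<close> depends on these
  coordinates only, their images separate points of \<open>K\<close>; one Urysohn function for each pair of cylinders
  with disjoint images gives a countable separating family.
\<close>

lemma metrizable_if_countably_many_sensitive:
  assumes "countable (sensitive (extensional I))"
  shows "metrizable_space K"
proof -
  define J where "J = sensitive (extensional I)"
  have J: "J \<subseteq> I" "countable J" using assms by (auto simp: J_def sensitive_def)
  define C where "C = (\<lambda>(a, b). cylinder I a (\<lambda>i. i \<in> b)) ` (Fpow J \<times> Fpow J)"
  have "countable C" using J by (simp add: C_def countable_Fpow)
  have closed: "closedin K (\<phi> ` c)" if "c \<in> C" for c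
  proof -
    have "closedin (cantor_cube I) c"
      using that J(1) by (auto simp: C_def Fpow_def intro!: closedin_cylinder)
    then show ?thesis
      using continuous_imp_closed_map_gen[OF compact_space_cantor_cube Hausdorff_imp_kc_space[OF Hausdorff_K] continuous_\<phi>]
      by (auto simp: closed_map_def)
  qed
  define P where "P = {(c, d). c \<in> C \<and> d \<in> C \<and> \<phi> ` c \<inter> \<phi> ` d = {}}"
  have "\<forall>cd\<in>P. \<exists>f. continuous_map K euclideanreal f \<and> (\<forall>p\<in>\<phi> ` fst cd. f p = 0) \<and> (\<forall>p\<in>\<phi> ` snd cd. f p = 1)"
  proof
    fix cd assume "cd \<in> P"
    then have "fst cd \<in> C" "snd cd \<in> C" "\<phi> ` fst cd \<inter> \<phi> ` snd cd = {}"
      by (simp_all add: P_def case_prod_beta)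
    then show "\<exists>f. continuous_map K euclideanreal f \<and> (\<forall>p\<in>\<phi> ` fst cd. f p = 0) \<and> (\<forall>p\<in>\<phi> ` snd cd. f p = 1)"
      using compact_Hausdorff_separating_function[OF compact_K Hausdorff_K closed closed] by metis
  qed
  then obtain F where F: "\<And>cd. cd \<in> P \<Longrightarrow> continuous_map K euclideanreal (F cd)"
    "\<And>cd p. cd \<in> P \<Longrightarrow> p \<in> \<phi> ` fst cd \<Longrightarrow> F cd p = 0" "\<And>cd p. cd \<in> P \<Longrightarrow> p \<in> \<phi> ` snd cd \<Longrightarrow> F cd p = 1"
    by metis
  have small: "\<exists>c\<in>C. x \<in> c \<and> \<phi> ` c \<subseteq> V" if x: "x \<in> extensional I" and V: "openin K V" "\<phi> x \<in> V" for x V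
  proof -
    obtain a where a: "finite a" "a \<subseteq> I" "cylinder I a x \<subseteq> preimage V"
      using cylinder_in_preimage[OF V(1) x V(2)] .
    let ?c = "cylinder I (a \<inter> J) (\<lambda>i. i \<in> {i \<in> a \<inter> J. x i})"
    have "?c \<in> C" unfolding C_def
      by (rule image_eqI[of _ _ "(a \<inter> J, {i \<in> a \<inter> J. x i})"]) (use a(1) in \<open>auto simp: Fpow_def\<close>)
    moreover have "x \<in> ?c" using x by (auto simp: cylinder_def)
    moreover have "\<phi> y \<in> V" if y: "y \<in> ?c" for y
    proof -
      define z where "z i = (if i \<in> a then x i else y i)" for i
      have z: "z \<in> cylinder I a x"
        using x y a(2) by (auto simp: z_def cylinder_def extensional_def)
      have "\<phi> y = \<phi> z"
        using y z by (intro determined_by_sensitive) (auto simp: z_def cylinder_def J_def)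
      with z a(3) show ?thesis by (auto simp: preimage_def)
    qed
    ultimately show ?thesis by blast
  qed
  show ?thesis
  proof (rule metrizable_of_countable_separating_family[OF compact_K, of "F ` P"])
    have "P \<subseteq> C \<times> C" by (auto simp: P_def)
    then show "countable (F ` P)"
      using \<open>countable C\<close> by (meson countable_SIGMA countable_image countable_subset)
    show "continuous_map K euclideanreal f" if "f \<in> F ` P" for f using that F(1) by auto
    fix p q assume pq: "p \<in> topspace K" "q \<in> topspace K" "p \<noteq> q"
    obtain U V where UV: "openin K U" "openin K V" "p \<in> U" "q \<in> V" "U \<inter> V = {}"
      using separate[OF pq] .
    obtain x y where xy: "x \<in> extensional I" "\<phi> x = p" "y \<in> extensional I" "\<phi> y = q"
      using pq surjective_\<phi> by (metis imageE)
    obtain c where c: "c \<in> C" "x \<in> c" "\<phi> ` c \<subseteq> U" using small UV xy by blast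
    obtain d where d: "d \<in> C" "y \<in> d" "\<phi> ` d \<subseteq> V" using small UV xy by blast
    have "(c, d) \<in> P" using c d UV(5) by (auto simp: P_def)
    moreover have "F (c, d) p = 0" "F (c, d) q = 1"
      using F(2,3)[OF \<open>(c, d) \<in> P\<close>] c d xy by auto
    ultimately show "\<exists>f\<in>F ` P. f p \<noteq> f q" by (metis imageI zero_neq_one)
  qed
qed

text \<open>
  By compactness, \<open>f \<circ> \<phi>\<close> depends on finitely many coordinates up to an error less than \<open>e\<close>.
\<close>

lemma finite_large_jumps:
  assumes f: "continuous_map K euclideanreal f" and e: "0 < (e::real)"
  shows "finite {t \<in> I. \<exists>x\<in>extensional I. e \<le> \<bar>f (\<phi> x) - f (\<phi> (flip t x))\<bar>}"
proof -
  have "\<exists>a. finite a \<and> a \<subseteq> I \<and> (\<forall>y\<in>cylinder I a x. \<bar>f (\<phi> y) - f (\<phi> x)\<bar> < e / 2)"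
    if x: "x \<in> extensional I" for x
  proof -
    have V: "openin K {p \<in> topspace K. f p \<in> ball (f (\<phi> x)) (e / 2)}"
      using f by (rule openin_continuous_map_preimage) simp
    obtain a where "finite a" "a \<subseteq> I"
      "cylinder I a x \<subseteq> preimage {p \<in> topspace K. f p \<in> ball (f (\<phi> x)) (e / 2)}"
      using cylinder_in_preimage[OF V x] \<phi>_in[OF x] e by auto
    then show ?thesis
      by (intro exI[of _ a]) (auto simp: preimage_def dist_real_def abs_minus_commute)
  qed
  then obtain a where a: "\<And>x. x \<in> extensional I \<Longrightarrow> finite (a x)" "\<And>x. x \<in> extensional I \<Longrightarrow> a x \<subseteq> I"
    "\<And>x y. x \<in> extensional I \<Longrightarrow> y \<in> cylinder I (a x) x \<Longrightarrow> \<bar>f (\<phi> y) - f (\<phi> x)\<bar> < e / 2"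
    by metis
  let ?U = "(\<lambda>x. cylinder I (a x) x) ` extensional I"
  have "\<forall>U\<in>?U. openin (cantor_cube I) U" using a(1,2) by (auto intro: openin_cylinder)
  moreover have "topspace (cantor_cube I) \<subseteq> \<Union>?U" by (auto simp: topspace_cantor_cube cylinder_def)
  ultimately obtain \<F> where "finite \<F>" "\<F> \<subseteq> ?U" "topspace (cantor_cube I) \<subseteq> \<Union>\<F>"
    using compact_space_cantor_cube[of I] unfolding compact_space_alt by meson
  then obtain X where X: "finite X" "X \<subseteq> extensional I" "extensional I \<subseteq> (\<Union>x\<in>X. cylinder I (a x) x)"
    using finite_subset_image[of \<F> "\<lambda>x. cylinder I (a x) x" "extensional I"]
    by (auto simp: topspace_cantor_cube)
  have "t \<in> (\<Union>x\<in>X. a x)"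
    if t: "t \<in> I" and y: "y \<in> extensional I" and large: "e \<le> \<bar>f (\<phi> y) - f (\<phi> (flip t y))\<bar>" for t y
  proof (rule ccontr)
    assume nt: "t \<notin> (\<Union>x\<in>X. a x)"
    obtain x where x: "x \<in> X" "y \<in> cylinder I (a x) x" using X(3) y by auto
    have "flip t y \<in> cylinder I (a x) x"
      using x nt flip_extensional[OF y t] by (auto simp: cylinder_def flip_def)
    with x X(2) have "\<bar>f (\<phi> y) - f (\<phi> x)\<bar> < e / 2" "\<bar>f (\<phi> (flip t y)) - f (\<phi> x)\<bar> < e / 2"
      using a(3) by blast+
    with large show False by linarith
  qed
  then have "{t \<in> I. \<exists>x\<in>extensional I. e \<le> \<bar>f (\<phi> x) - f (\<phi> (flip t x))\<bar>} \<subseteq> (\<Union>x\<in>X. a x)" by blast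
  moreover have "finite (\<Union>x\<in>X. a x)" using X a(1) by auto
  ultimately show ?thesis by (rule finite_subset)
qed

lemma jump_persists:
  assumes x: "x \<in> extensional I" and t: "t \<in> I" and ne: "\<phi> x \<noteq> \<phi> (flip t x)"
  obtains a where "finite a" "a \<subseteq> I" "\<And>y. y \<in> cylinder I a x \<Longrightarrow> \<phi> y \<noteq> \<phi> (flip t y)"
proof -
  note fx = flip_extensional[OF x t]
  obtain U V where UV: "openin K U" "openin K V" "\<phi> x \<in> U" "\<phi> (flip t x) \<in> V" "U \<inter> V = {}"
    using separate[OF \<phi>_in[OF x] \<phi>_in[OF fx] ne] .
  obtain a where a: "finite a" "a \<subseteq> I" "cylinder I a x \<subseteq> preimage U"
    using cylinder_in_preimage[OF UV(1) x UV(3)] .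
  obtain b where b: "finite b" "b \<subseteq> I" "cylinder I b (flip t x) \<subseteq> preimage V"
    using cylinder_in_preimage[OF UV(2) fx UV(4)] .
  show ?thesis
  proof (rule that[of "insert t (a \<union> b)"])
    fix y assume y: "y \<in> cylinder I (insert t (a \<union> b)) x"
    then have ext: "y \<in> extensional I" by (simp add: cylinder_def)
    have "y \<in> cylinder I a x" using y by (auto simp: cylinder_def)
    moreover have "flip t y \<in> cylinder I b (flip t x)"
      using y flip_extensional[OF ext t] by (auto simp: cylinder_def flip_def)
    ultimately have "\<phi> y \<in> U" "\<phi> (flip t y) \<in> V" using a(3) b(3) by (auto simp: preimage_def)
    with UV(5) show "\<phi> y \<noteq> \<phi> (flip t y)" by auto
  qed (use a b t in auto)
qed

text \<open>
  A Lindelof-like property that arbitrary subsets of the cube have because of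
  \<open>uncountable_compatible\<close>. Uncountably many sensitive coordinates come with cylinders on which the
  respective flip changes \<open>\<phi>\<close>; one of these cylinders meets uncountably many of the others, so that
  uncountably many coordinates are sensitive on it.
\<close>

lemma countable_sensitive_if_locally_countable:
  assumes W: "W \<subseteq> extensional I"
    and loc: "\<And>x. x \<in> W \<Longrightarrow> \<exists>a. finite a \<and> a \<subseteq> I \<and> countable (sensitive (cylinder I a x))"
  shows "countable (sensitive W)"
proof (rule ccontr)
  assume unc: "uncountable (sensitive W)"
  have "\<exists>x a. x \<in> W \<and> finite a \<and> a \<subseteq> I \<and> countable (sensitive (cylinder I a x)) \<and>
      (\<forall>y\<in>cylinder I a x. \<phi> y \<noteq> \<phi> (flip t y))" if ts: "t \<in> sensitive W" for t
  proof -
    obtain x where x: "t \<in> I" "x \<in> W" "\<phi> x \<noteq> \<phi> (flip t x)"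
      using ts unfolding sensitive_def by blast
    obtain a where a: "finite a" "a \<subseteq> I" "countable (sensitive (cylinder I a x))" using loc[OF x(2)] by blast
    obtain b where b: "finite b" "b \<subseteq> I" "\<And>y. y \<in> cylinder I b x \<Longrightarrow> \<phi> y \<noteq> \<phi> (flip t y)"
      using jump_persists[of x t] x W by blast
    have sub: "cylinder I (a \<union> b) x \<subseteq> cylinder I a x" "cylinder I (a \<union> b) x \<subseteq> cylinder I b x"
      by (auto simp: cylinder_def)
    then have "sensitive (cylinder I (a \<union> b) x) \<subseteq> sensitive (cylinder I a x)"
      by (auto simp: sensitive_def)
    with a(3) have "countable (sensitive (cylinder I (a \<union> b) x))" by (rule countable_subset[rotated])
    with x(2) a b sub show ?thesis by (intro exI[of _ x] exI[of _ "a \<union> b"]) auto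
  qed
  then obtain x a where xa: "\<And>t. t \<in> sensitive W \<Longrightarrow> x t \<in> W" "\<And>t. t \<in> sensitive W \<Longrightarrow> finite (a t)"
    "\<And>t. t \<in> sensitive W \<Longrightarrow> countable (sensitive (cylinder I (a t) (x t)))"
    "\<And>t y. t \<in> sensitive W \<Longrightarrow> y \<in> cylinder I (a t) (x t) \<Longrightarrow> \<phi> y \<noteq> \<phi> (flip t y)"
    by metis
  obtain s where s: "s \<in> sensitive W"
    and u: "uncountable {t \<in> sensitive W. \<forall>i\<in>a s \<inter> a t. x s i = x t i}"
    using uncountable_compatible[OF unc, of a x] xa(2) by blast
  have "{t \<in> sensitive W. \<forall>i\<in>a s \<inter> a t. x s i = x t i} \<subseteq> sensitive (cylinder I (a s) (x s))"
  proof
    fix t assume t: "t \<in> {t \<in> sensitive W. \<forall>i\<in>a s \<inter> a t. x s i = x t i}"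
    define y where "y i = (if i \<in> a s then x s i else x t i)" for i
    have "x s \<in> extensional I" "x t \<in> extensional I" using xa(1) s t W by auto
    then have ext: "y \<in> extensional I" by (auto simp: y_def extensional_def)
    then have "y \<in> cylinder I (a s) (x s)" by (auto simp: y_def cylinder_def)
    moreover have "y \<in> cylinder I (a t) (x t)" using t ext by (auto simp: y_def cylinder_def)
    ultimately show "t \<in> sensitive (cylinder I (a s) (x s))"
      using xa(4)[of t y] t by (auto simp: sensitive_def)
  qed
  with u xa(3)[OF s] show False by (meson countable_subset)
qed

definition heavy :: "'a set" where
  "heavy = {p \<in> topspace K. \<forall>V. openin K V \<and> p \<in> V \<longrightarrow> uncountable (sensitive (preimage V))}"

text \<open>
  If there are only finitely many heavy points, a flip leading from one of them to another is a jump of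
  fixed size for one of finitely many Urysohn functions, which happens at finitely many coordinates only.
  Every other sensitive flip starts or ends at a point outside the heavy fibres, and the coordinates
  sensitive there are countably many since they are so locally.
\<close>

lemma infinite_heavy:
  assumes unc: "uncountable (sensitive (extensional I))"
  shows "infinite heavy"
proof
  assume fin: "finite heavy"
  define W where "W = {x \<in> extensional I. \<phi> x \<notin> heavy}"
  have "countable (sensitive W)"
  proof (rule countable_sensitive_if_locally_countable)
    fix x assume "x \<in> W"
    then have x: "x \<in> extensional I" "\<phi> x \<notin> heavy" by (auto simp: W_def)
    then obtain V where V: "openin K V" "\<phi> x \<in> V" "countable (sensitive (preimage V))"
      using \<phi>_in by (auto simp: heavy_def)
    obtain a where a: "finite a" "a \<subseteq> I" "cylinder I a x \<subseteq> preimage V"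
      using cylinder_in_preimage[OF V(1) x(1) V(2)] .
    have "sensitive (cylinder I a x) \<subseteq> sensitive (preimage V)"
      using a(3) by (auto simp: sensitive_def)
    then have "countable (sensitive (cylinder I a x))" using V(3) by (rule countable_subset)
    with a show "\<exists>a. finite a \<and> a \<subseteq> I \<and> countable (sensitive (cylinder I a x))"
      by (intro exI[of _ a]) simp
  qed (auto simp: W_def)
  define B where "B g h = {t \<in> I. \<exists>x\<in>extensional I. \<phi> x = g \<and> \<phi> (flip t x) = h}" for g h
  have fin_B: "finite (B g h)" if gh: "g \<in> heavy" "h \<in> heavy" "g \<noteq> h" for g h
  proof -
    have top: "g \<in> topspace K" "h \<in> topspace K" using gh by (auto simp: heavy_def)
    then have cl: "closedin K {g}" "closedin K {h}"
      using Hausdorff_K by (auto simp: closedin_Hausdorff_singleton)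
    obtain f where f: "continuous_map K euclideanreal f" "f g = 0" "f h = 1"
      using compact_Hausdorff_separating_function[OF compact_K Hausdorff_K cl] gh(3) by auto
    have "B g h \<subseteq> {t \<in> I. \<exists>x\<in>extensional I. 1 \<le> \<bar>f (\<phi> x) - f (\<phi> (flip t x))\<bar>}"
      using f by (auto simp: B_def) force
    then show ?thesis using finite_large_jumps[OF f(1), of 1] finite_subset by auto
  qed
  have "sensitive (extensional I) \<subseteq> sensitive W \<union> (\<Union>(g, h)\<in>{(g, h) \<in> heavy \<times> heavy. g \<noteq> h}. B g h)"
  proof
    fix t assume "t \<in> sensitive (extensional I)"
    then obtain x where t: "t \<in> I" and x: "x \<in> extensional I" "\<phi> x \<noteq> \<phi> (flip t x)"
      by (auto simp: sensitive_def)
    show "t \<in> sensitive W \<union> (\<Union>(g, h)\<in>{(g, h) \<in> heavy \<times> heavy. g \<noteq> h}. B g h)"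
    proof (cases "\<phi> x \<in> heavy \<and> \<phi> (flip t x) \<in> heavy")
      case True
      moreover have "t \<in> B (\<phi> x) (\<phi> (flip t x))" using t x by (auto simp: B_def)
      ultimately show ?thesis using x(2) by auto
    next
      case False
      then have "x \<in> W \<or> flip t x \<in> W" using x flip_extensional[OF x(1) t] by (auto simp: W_def)
      then have "\<exists>z\<in>W. \<phi> z \<noteq> \<phi> (flip t z)" using x(2) by (metis flip_flip)
      then show ?thesis using t by (auto simp: sensitive_def)
    qed
  qed
  moreover have "finite (\<Union>(g, h)\<in>{(g, h) \<in> heavy \<times> heavy. g \<noteq> h}. B g h)"
    by (rule finite_UN_I) (auto simp: fin_B intro: finite_subset[OF _ finite_cartesian_product[OF fin fin]])
  ultimately show False
    using unc \<open>countable (sensitive W)\<close> by (meson countable_Un countable_finite countable_subset)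
qed

lemma disjoint_open_sets_with_uncountably_many_sensitive:
  assumes "\<not> metrizable_space K"
  obtains V :: "nat \<Rightarrow> 'a set" where "\<And>i. openin K (V i)" "disjoint_family V"
    "\<And>i. uncountable (sensitive (preimage (V i)))"
proof -
  have "infinite heavy"
    using assms metrizable_if_countably_many_sensitive infinite_heavy by blast
  moreover have "heavy \<subseteq> topspace K" by (auto simp: heavy_def)
  ultimately obtain V :: "nat \<Rightarrow> 'a set" where V: "\<And>i. openin K (V i)" "\<And>i. V i \<inter> heavy \<noteq> {}" "disjoint_family V"
    using disjoint_open_sequence[OF compact_Hausdorff_imp_regular_space[OF compact_K Hausdorff_K] Hausdorff_K] by blast
  have "uncountable (sensitive (preimage (V i)))" for i
    using V(1,2)[of i] by (auto simp: heavy_def)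
  with V show ?thesis using that by blast
qed

end

section \<open>Twisted sums from almost disjoint families\<close>

definition along :: "nat set \<Rightarrow> nat filter" where
  "along B = inf sequentially (principal B)"

lemma tendsto_along_iff:
  "(h \<longlongrightarrow> (l::real)) (along B) \<longleftrightarrow> (\<forall>e>0. finite {n \<in> B. e \<le> \<bar>h n - l\<bar>})"
proof -
  have "{n. \<not> (n \<in> B \<longrightarrow> dist (h n) l < e)} = {n \<in> B. e \<le> \<bar>h n - l\<bar>}" for e
    by (auto simp: dist_real_def)
  then show ?thesis
    unfolding tendsto_iff along_def eventually_inf_principal
    by (simp add: eventually_cofinite flip: cofinite_eq_sequentially)
qed

lemma sup_normed_simps [simp]:
  "vcarrier (sup_normed S A) = A"
  "vzero (sup_normed S A) = (\<lambda>x\<in>S. 0)"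
  "vadd (sup_normed S A) f g = (\<lambda>x\<in>S. f x + g x)"
  "vscale (sup_normed S A) a f = (\<lambda>x\<in>S. a * f x)"
  by (simp_all add: sup_normed_def)

lemma sup_normed_norm_le:
  assumes "0 \<le> B" "\<And>x. x \<in> S \<Longrightarrow> \<bar>f x\<bar> \<le> B"
  shows "vnorm (sup_normed S A) f \<le> B"
  using assms by (auto simp: sup_normed_def intro!: cSup_least)

lemma sup_normed_norm_ge:
  assumes "\<And>x. x \<in> S \<Longrightarrow> \<bar>f x\<bar> \<le> B"
  shows "x \<in> S \<Longrightarrow> \<bar>f x\<bar> \<le> vnorm (sup_normed S A) f" "0 \<le> vnorm (sup_normed S A) f"
proof -
  have "bdd_above (insert 0 ((\<lambda>x. \<bar>f x\<bar>) ` S))"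
    using assms by (auto simp: bdd_above_def intro!: exI[of _ "max 0 B"]) fastforce
  then show "x \<in> S \<Longrightarrow> \<bar>f x\<bar> \<le> vnorm (sup_normed S A) f" "0 \<le> vnorm (sup_normed S A) f"
    by (auto simp: sup_normed_def intro!: cSup_upper)
qed

lemma compact_space_continuous_bounded:
  assumes "compact_space K" "continuous_map K euclideanreal f"
  obtains B where "0 \<le> B" "\<And>x. x \<in> topspace K \<Longrightarrow> \<bar>f x\<bar> \<le> B"
proof -
  have "compact (f ` topspace K)"
    using assms image_compactin[of K "topspace K" euclideanreal f]
    by (simp add: compact_space_def)
  then obtain B where "\<forall>y\<in>f ` topspace K. norm y \<le> B" using compact_imp_bounded bounded_iff by metis
  then show ?thesis using that[of "max 0 B"] by fastforce
qed

lemma c0_carrier [simp]: "vcarrier c0_space = {z. z \<longlonglongrightarrow> 0}"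
  by (simp add: c0_space_def)

lemma C_carrier [simp]:
  "vcarrier (C_space K) = {f \<in> extensional (topspace K). continuous_map K euclideanreal f}"
  by (simp add: C_space_def)

lemma c0_norm_ge:
  assumes "z \<longlonglongrightarrow> (0::real)"
  shows "\<bar>z n\<bar> \<le> vnorm c0_space z" "0 \<le> vnorm c0_space z"
proof -
  obtain B where "\<bar>z n\<bar> \<le> B" for n
    using convergentI[OF assms, THEN convergent_imp_Bseq] by (auto simp: Bseq_def)
  then show "\<bar>z n\<bar> \<le> vnorm c0_space z" "0 \<le> vnorm c0_space z"
    using sup_normed_norm_ge[of UNIV z B] by (auto simp: c0_space_def)
qed

locale almost_disjoint_jumps =
  fixes K :: "'a topology" and A :: "'g \<Rightarrow> nat set" and w :: "'g \<Rightarrow> real" and p q :: "'g \<Rightarrow> 'a"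
  assumes compact_K: "compact_space K"
    and almost_disjoint: "\<And>s t. s \<noteq> t \<Longrightarrow> finite (A s \<inter> A t)"
    and p_in: "\<And>t. p t \<in> topspace K" and q_in: "\<And>t. q t \<in> topspace K"
    and w_le: "\<And>t. \<bar>w t\<bar> \<le> 1"
    and null: "\<And>f e. \<lbrakk>continuous_map K euclideanreal f; 0 < e\<rbrakk> \<Longrightarrow>
      finite {t. e \<le> \<bar>w t * (f (p t) - f (q t))\<bar>}"
begin

definition jump :: "'g \<Rightarrow> ('a \<Rightarrow> real) \<Rightarrow> real" where
  "jump t f = w t * (f (p t) - f (q t))"

definition points :: "(nat + 'a) set" where
  "points = range Inl \<union> Inr ` topspace K"

text \<open>
  The functions on the disjoint union of the natural numbers and \<open>K\<close> whose sequence part represents, modulo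
  $c_0$, the element $\sum_t w_t (f(p_t) - f(q_t)) \chi_{A_t}$ of $\ell_\infty/c_0$, where $f$ is their part on
  \<open>K\<close>. The sum need not make sense as a function, but its class is determined by its limits along the sets \<open>A t\<close> and
  along the sets that are almost disjoint from all of them; conditions on limits are also
  evidently linear and closed under uniform convergence.
\<close>

definition carrier :: "(nat + 'a \<Rightarrow> real) set" where
  "carrier = {h \<in> extensional points. continuous_map K euclideanreal (\<lambda>x. h (Inr x)) \<and>
    Bseq (\<lambda>n. h (Inl n)) \<and>
    (\<forall>t. ((\<lambda>n. h (Inl n)) \<longlongrightarrow> jump t (\<lambda>x. h (Inr x))) (along (A t))) \<and>
    (\<forall>B. (\<forall>t. finite (B \<inter> A t)) \<longrightarrow> ((\<lambda>n. h (Inl n)) \<longlongrightarrow> 0) (along B))}"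

definition middle :: "(nat + 'a \<Rightarrow> real) normed_structure" where
  "middle = sup_normed points carrier"

definition embed :: "(nat \<Rightarrow> real) \<Rightarrow> nat + 'a \<Rightarrow> real" where
  "embed z = (\<lambda>s\<in>points. case s of Inl n \<Rightarrow> z n | Inr x \<Rightarrow> 0)"

definition quot :: "(nat + 'a \<Rightarrow> real) \<Rightarrow> 'a \<Rightarrow> real" where
  "quot h = (\<lambda>x\<in>topspace K. h (Inr x))"

lemma in_points [simp]: "Inl n \<in> points" "Inr x \<in> points \<longleftrightarrow> x \<in> topspace K"
  by (auto simp: points_def)

lemma ball_points: "(\<forall>s\<in>points. P s) \<longleftrightarrow> (\<forall>n. P (Inl n)) \<and> (\<forall>x\<in>topspace K. P (Inr x))"
  by (auto simp: points_def)

lemma jump_cong: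
  assumes "\<And>x. x \<in> topspace K \<Longrightarrow> f x = g x"
  shows "jump t f = jump t g"
  using assms p_in q_in by (simp add: jump_def)

lemma restrict_in_carrier:
  assumes cont: "continuous_map K euclideanreal (\<lambda>x. h (Inr x))" and "Bseq (\<lambda>n. h (Inl n))"
    and "\<And>t. ((\<lambda>n. h (Inl n)) \<longlongrightarrow> jump t (\<lambda>x. h (Inr x))) (along (A t))"
    and "\<And>B. (\<forall>t. finite (B \<inter> A t)) \<Longrightarrow> ((\<lambda>n. h (Inl n)) \<longlongrightarrow> 0) (along B)"
  shows "restrict h points \<in> carrier"
proof -
  have "jump t (\<lambda>x. restrict h points (Inr x)) = jump t (\<lambda>x. h (Inr x))" for t
    by (rule jump_cong) simp
  moreover have "continuous_map K euclideanreal (\<lambda>x. restrict h points (Inr x))"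
    using cont by (rule continuous_map_eq) simp
  ultimately show ?thesis using assms by (simp add: carrier_def)
qed

lemma carrier_bounded:
  assumes "h \<in> carrier"
  obtains B where "0 \<le> B" "\<And>s. s \<in> points \<Longrightarrow> \<bar>h s\<bar> \<le> B"
proof -
  obtain B1 where "\<And>n. \<bar>h (Inl n)\<bar> \<le> B1" using assms by (auto simp: carrier_def Bseq_def)
  moreover obtain B2 where "0 \<le> B2" "\<And>x. x \<in> topspace K \<Longrightarrow> \<bar>h (Inr x)\<bar> \<le> B2"
    using compact_space_continuous_bounded[OF compact_K] assms by (auto simp: carrier_def)
  ultimately have "0 \<le> max B1 B2" "\<And>s. s \<in> points \<Longrightarrow> \<bar>h s\<bar> \<le> max B1 B2"
    by (auto simp: points_def le_max_iff_disj)
  then show ?thesis by (rule that)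
qed

lemma carrier_add: "\<lbrakk>f \<in> carrier; g \<in> carrier\<rbrakk> \<Longrightarrow> (\<lambda>s\<in>points. f s + g s) \<in> carrier"
proof (rule restrict_in_carrier)
  assume f: "f \<in> carrier" and g: "g \<in> carrier"
  show "continuous_map K euclideanreal (\<lambda>x. f (Inr x) + g (Inr x))"
    using f g by (auto simp: carrier_def intro: continuous_map_add)
  show "Bseq (\<lambda>n. f (Inl n) + g (Inl n))"
  proof -
    obtain B C where "\<And>n. \<bar>f (Inl n)\<bar> \<le> B" "\<And>n. \<bar>g (Inl n)\<bar> \<le> C"
      using f g by (auto simp: carrier_def Bseq_def)
    then have "\<bar>f (Inl n) + g (Inl n)\<bar> \<le> B + C" for n by (meson abs_triangle_ineq add_mono order_trans)
    then show ?thesis by (intro BseqI'[of _ "B + C"]) simp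
  qed
  show "((\<lambda>n. f (Inl n) + g (Inl n)) \<longlongrightarrow> jump t (\<lambda>x. f (Inr x) + g (Inr x))) (along (A t))" for t
  proof -
    have "jump t (\<lambda>x. f (Inr x) + g (Inr x)) = jump t (\<lambda>x. f (Inr x)) + jump t (\<lambda>x. g (Inr x))"
      by (simp add: jump_def algebra_simps)
    then show ?thesis using f g by (auto simp: carrier_def intro: tendsto_add)
  qed
  show "((\<lambda>n. f (Inl n) + g (Inl n)) \<longlongrightarrow> 0) (along B)" if "\<forall>t. finite (B \<inter> A t)" for B
    using f g that by (auto simp: carrier_def intro: tendsto_add_zero)
qed

lemma carrier_scale: "f \<in> carrier \<Longrightarrow> (\<lambda>s\<in>points. a * f s) \<in> carrier"
proof (rule restrict_in_carrier)
  assume f: "f \<in> carrier"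
  show "continuous_map K euclideanreal (\<lambda>x. a * f (Inr x))"
    using f by (auto simp: carrier_def intro: continuous_map_real_mult)
  show "Bseq (\<lambda>n. a * f (Inl n))"
    using f by (auto simp: carrier_def intro: Bseq_mult)
  show "((\<lambda>n. a * f (Inl n)) \<longlongrightarrow> jump t (\<lambda>x. a * f (Inr x))) (along (A t))" for t
  proof -
    have "jump t (\<lambda>x. a * f (Inr x)) = a * jump t (\<lambda>x. f (Inr x))"
      by (simp add: jump_def algebra_simps)
    then show ?thesis using f by (auto simp: carrier_def intro: tendsto_mult_left)
  qed
  show "((\<lambda>n. a * f (Inl n)) \<longlongrightarrow> 0) (along B)" if "\<forall>t. finite (B \<inter> A t)" for B
    using f that by (auto simp: carrier_def intro: tendsto_mult_right_zero)
qed

lemma carrier_uniform_limit: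
  assumes \<sigma>: "\<And>k. \<sigma> k \<in> carrier" and ext: "f \<in> extensional points"
    and lim: "uniform_limit points \<sigma> f sequentially"
  shows "f \<in> carrier"
proof -
  have limR: "uniform_limit (topspace K) (\<lambda>k x. \<sigma> k (Inr x)) (\<lambda>x. f (Inr x)) sequentially"
    using lim unfolding uniform_limit_iff ball_points by (fastforce elim!: eventually_mono)
  have limL: "uniform_limit UNIV (\<lambda>k n. \<sigma> k (Inl n)) (\<lambda>n. f (Inl n)) sequentially"
    using lim unfolding uniform_limit_iff ball_points by (fastforce elim!: eventually_mono)
  have "continuous_map K Met_TC.mtopology (\<lambda>x. f (Inr x))"
  proof (rule Met_TC.continuous_map_uniform_limit[where F = sequentially and f = "\<lambda>k x. \<sigma> k (Inr x)"])
    show "\<forall>\<^sub>F k in sequentially. continuous_map K Met_TC.mtopology (\<lambda>x. \<sigma> k (Inr x))"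
      using \<sigma> by (simp add: carrier_def)
    show "\<forall>\<^sub>F k in sequentially. \<forall>x\<in>topspace K. f (Inr x) \<in> UNIV \<and> dist (\<sigma> k (Inr x)) (f (Inr x)) < e"
      if "0 < e" for e
      using uniform_limitD[OF limR that] by simp
  qed auto
  then have cont: "continuous_map K euclideanreal (\<lambda>x. f (Inr x))" by simp
  obtain k where k: "\<And>n. dist (\<sigma> k (Inl n)) (f (Inl n)) < 1"
    using uniform_limitD[OF limL zero_less_one] by (auto simp: eventually_sequentially)
  obtain B where B: "\<And>n. \<bar>\<sigma> k (Inl n)\<bar> \<le> B" using \<sigma>[of k] by (auto simp: carrier_def Bseq_def)
  have "\<bar>f (Inl n)\<bar> \<le> B + 1" for n using k[of n] B[of n] by (auto simp: dist_real_def)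
  then have bdd: "Bseq (\<lambda>n. f (Inl n))" by (intro BseqI'[of _ "B + 1"]) simp
  have "((\<lambda>n. f (Inl n)) \<longlongrightarrow> jump t (\<lambda>x. f (Inr x))) (along (A t))" for t
  proof (rule swap_uniform_limit'[OF _ _ limL])
    show "\<forall>\<^sub>F k in sequentially. ((\<lambda>n. \<sigma> k (Inl n)) \<longlongrightarrow> jump t (\<lambda>x. \<sigma> k (Inr x))) (along (A t))"
      using \<sigma> by (simp add: carrier_def)
    have "(\<lambda>k. \<sigma> k (Inr x)) \<longlonglongrightarrow> f (Inr x)" if "x \<in> topspace K" for x
      using tendsto_uniform_limitI[OF limR that] .
    then show "(\<lambda>k. jump t (\<lambda>x. \<sigma> k (Inr x))) \<longlonglongrightarrow> jump t (\<lambda>x. f (Inr x))"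
      unfolding jump_def using p_in q_in by (intro tendsto_intros) auto
  qed auto
  moreover have "((\<lambda>n. f (Inl n)) \<longlongrightarrow> 0) (along B)" if "\<forall>t. finite (B \<inter> A t)" for B
  proof (rule swap_uniform_limit'[OF _ _ limL])
    show "\<forall>\<^sub>F k in sequentially. ((\<lambda>n. \<sigma> k (Inl n)) \<longlongrightarrow> 0) (along B)"
      using \<sigma> that by (simp add: carrier_def)
  qed auto
  ultimately show ?thesis using ext cont bdd by (simp add: carrier_def)
qed

lemma banach_space_middle: "banach_space middle"
  unfolding middle_def
proof (rule banach_space_sup_normed)
  show "carrier \<subseteq> extensional points" by (auto simp: carrier_def)
  show "\<exists>B. \<forall>s\<in>points. \<bar>h s\<bar> \<le> B" if "h \<in> carrier" for h using carrier_bounded[OF that] by metis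
  show "(\<lambda>s\<in>points. 0) \<in> carrier" by (rule restrict_in_carrier) (auto simp: jump_def)
qed (auto intro: carrier_add carrier_scale carrier_uniform_limit)

lemma middle_carrier [simp]: "vcarrier middle = carrier"
  by (simp add: middle_def)

lemma middle_norm_ge:
  assumes "h \<in> carrier" "s \<in> points"
  shows "\<bar>h s\<bar> \<le> vnorm middle h"
proof -
  obtain B where "\<And>s. s \<in> points \<Longrightarrow> \<bar>h s\<bar> \<le> B" using carrier_bounded[OF assms(1)] by metis
  then show ?thesis unfolding middle_def using assms(2) by (rule sup_normed_norm_ge(1))
qed

lemma middle_norm_nonneg: "h \<in> carrier \<Longrightarrow> 0 \<le> vnorm middle h"
  using middle_norm_ge[of h "Inl 0"] by simp

lemma embed_in_carrier:
  assumes "z \<longlonglongrightarrow> 0"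
  shows "embed z \<in> carrier"
  unfolding embed_def
proof (rule restrict_in_carrier)
  show "Bseq (\<lambda>n. case Inl n :: nat + 'a of Inl n \<Rightarrow> z n | Inr x \<Rightarrow> 0)"
    using convergentI[OF assms, THEN convergent_imp_Bseq] by simp
  have "(z \<longlongrightarrow> 0) (along B)" for B using assms by (rule tendsto_mono[rotated]) (simp add: along_def)
  then show "((\<lambda>n. case Inl n :: nat + 'a of Inl n \<Rightarrow> z n | Inr x \<Rightarrow> 0) \<longlongrightarrow> 0) (along B)"
    "((\<lambda>n. case Inl n :: nat + 'a of Inl n \<Rightarrow> z n | Inr x \<Rightarrow> 0) \<longlongrightarrow>
      jump t (\<lambda>x. case Inr x :: nat + 'a of Inl n \<Rightarrow> z n | Inr x \<Rightarrow> 0)) (along (A t))" for B t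
    by (simp_all add: jump_def)
qed simp

text \<open>
  A level set \<open>{n. e \<le> \<bar>h (Inl n)\<bar>}\<close> is almost disjoint from every \<open>A t\<close>, so the last condition in
  \<open>carrier_def\<close> applies to the level set itself.
\<close>

lemma quot_zero_imp_null:
  assumes h: "h \<in> carrier" and zero: "\<And>x. x \<in> topspace K \<Longrightarrow> h (Inr x) = 0"
  shows "(\<lambda>n. h (Inl n)) \<longlonglongrightarrow> 0"
proof -
  have "jump t (\<lambda>x. h (Inr x)) = 0" for t using zero p_in q_in by (simp add: jump_def)
  then have At: "((\<lambda>n. h (Inl n)) \<longlongrightarrow> 0) (along (A t))" for t using h by (auto simp: carrier_def)
  have "finite {n. e \<le> \<bar>h (Inl n)\<bar>}" if "0 < e" for e
  proof -
    let ?E = "{n. e \<le> \<bar>h (Inl n)\<bar>}"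
    have "finite (?E \<inter> A t)" for t
    proof -
      have "?E \<inter> A t = {n \<in> A t. e \<le> \<bar>h (Inl n) - 0\<bar>}" by auto
      then show ?thesis using At[of t] \<open>0 < e\<close> unfolding tendsto_along_iff by simp
    qed
    then have "((\<lambda>n. h (Inl n)) \<longlongrightarrow> 0) (along ?E)" using h by (simp add: carrier_def)
    then have "finite {n \<in> ?E. e \<le> \<bar>h (Inl n) - 0\<bar>}" using \<open>0 < e\<close> unfolding tendsto_along_iff by blast
    then show ?thesis by simp
  qed
  then have "((\<lambda>n. h (Inl n)) \<longlongrightarrow> 0) (along UNIV)" by (simp add: tendsto_along_iff)
  then show ?thesis by (simp add: along_def)
qed

text \<open>
  Only countably many \<open>t\<close> have a nonzero jump. The corresponding sets \<open>A t\<close> become disjoint when each is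
  diminished by its predecessors in an enumeration, which removes only a finite part of each,
  and \<open>h\<close> takes the value \<open>jump t f\<close> on what remains of \<open>A t\<close>.
\<close>

lemma exists_bounded_lift:
  assumes f: "f \<in> vcarrier (C_space K)" and N: "0 \<le> N" "\<And>x. x \<in> topspace K \<Longrightarrow> \<bar>f x\<bar> \<le> N"
  obtains h where "h \<in> carrier" "quot h = f" "\<And>n. \<bar>h (Inl n)\<bar> \<le> 2 * N"
proof -
  have cont: "continuous_map K euclideanreal f" and ext: "f \<in> extensional (topspace K)" using f by auto
  define D where "D = {t. jump t f \<noteq> 0}"
  have fin: "finite {t. e \<le> \<bar>jump t f\<bar>}" if "0 < e" for e
    using null[OF cont that] by (simp add: jump_def)
  have "D \<subseteq> (\<Union>k. {t. 1 / real (Suc k) \<le> \<bar>jump t f\<bar>})"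
  proof
    fix t assume "t \<in> D"
    then have "0 < \<bar>jump t f\<bar>" by (simp add: D_def)
    then obtain k where "1 / real (Suc k) < \<bar>jump t f\<bar>" using nat_approx_posE by blast
    then show "t \<in> (\<Union>k. {t. 1 / real (Suc k) \<le> \<bar>jump t f\<bar>})" by (auto intro: less_imp_le)
  qed
  moreover have "countable (\<Union>k. {t. 1 / real (Suc k) \<le> \<bar>jump t f\<bar>})"
    by (intro countable_UN countableI_type countable_finite fin) simp
  ultimately have "countable D" by (rule countable_subset)
  define rank where "rank = to_nat_on D"
  have inj: "inj_on rank D" unfolding rank_def using \<open>countable D\<close> by (rule inj_on_to_nat_on)
  define m where "m n = arg_min rank (\<lambda>t. t \<in> D \<and> n \<in> A t)" for n
  have m: "m n \<in> D" "n \<in> A (m n)" "rank (m n) \<le> rank t" if "t \<in> D" "n \<in> A t" for n t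
    unfolding m_def using arg_min_nat_lemma[of "\<lambda>t. t \<in> D \<and> n \<in> A t" t rank] that by auto
  define g where "g n = (if \<exists>t\<in>D. n \<in> A t then jump (m n) f else 0)" for n
  define h where "h = (\<lambda>s\<in>points. case s of Inl n \<Rightarrow> g n | Inr x \<Rightarrow> f x)"
  have jump_le: "\<bar>jump t f\<bar> \<le> 2 * N" for t
  proof -
    have "\<bar>f (p t) - f (q t)\<bar> \<le> 2 * N" using N(2)[OF p_in, of t] N(2)[OF q_in, of t] by linarith
    then have "\<bar>w t\<bar> * \<bar>f (p t) - f (q t)\<bar> \<le> 1 * (2 * N)" using w_le by (intro mult_mono) auto
    then show ?thesis by (simp add: jump_def abs_mult)
  qed
  have g_le: "\<bar>g n\<bar> \<le> 2 * N" for n using jump_le N(1) by (simp add: g_def)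
  have g_null: "(g \<longlongrightarrow> 0) (along B)" if B: "\<And>t. t \<in> D \<Longrightarrow> finite (B \<inter> A t)" for B
    unfolding tendsto_along_iff
  proof (intro allI impI)
    fix e :: real assume "0 < e"
    have "{n \<in> B. e \<le> \<bar>g n - 0\<bar>} \<subseteq> (\<Union>t\<in>{t. e \<le> \<bar>jump t f\<bar>}. B \<inter> A t)"
    proof
      fix n assume n: "n \<in> {n \<in> B. e \<le> \<bar>g n - 0\<bar>}"
      then obtain t where "t \<in> D" "n \<in> A t" using \<open>0 < e\<close> by (auto simp: g_def split: if_splits)
      with m[OF this] n show "n \<in> (\<Union>t\<in>{t. e \<le> \<bar>jump t f\<bar>}. B \<inter> A t)"
        by (auto simp: g_def split: if_splits)
    qed
    moreover have "finite (\<Union>t\<in>{t. e \<le> \<bar>jump t f\<bar>}. B \<inter> A t)"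
      using fin[OF \<open>0 < e\<close>] by (rule finite_UN_I) (use B \<open>0 < e\<close> in \<open>auto simp: D_def\<close>)
    ultimately show "finite {n \<in> B. e \<le> \<bar>g n - 0\<bar>}" by (rule finite_subset)
  qed
  have g_jump: "(g \<longlongrightarrow> jump t f) (along (A t))" for t
  proof (cases "t \<in> D")
    case False
    then have "(g \<longlongrightarrow> 0) (along (A t))" by (intro g_null) (metis almost_disjoint)
    with False show ?thesis by (simp add: D_def)
  next
    case True
    have "{n \<in> A t. e \<le> \<bar>g n - jump t f\<bar>} \<subseteq> (\<Union>s\<in>{s \<in> D. rank s < rank t}. A s \<inter> A t)" if "0 < e" for e
    proof
      fix n assume n: "n \<in> {n \<in> A t. e \<le> \<bar>g n - jump t f\<bar>}"
      then have "m n \<noteq> t" using True \<open>0 < e\<close> by (auto simp: g_def split: if_splits)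
      moreover have mn: "m n \<in> D" "n \<in> A (m n)" "rank (m n) \<le> rank t" using m[OF True] n by auto
      ultimately have "rank (m n) < rank t" using inj True by (metis inj_onD le_neq_implies_less)
      with mn n show "n \<in> (\<Union>s\<in>{s \<in> D. rank s < rank t}. A s \<inter> A t)" by auto
    qed
    moreover have "finite (\<Union>s\<in>{s \<in> D. rank s < rank t}. A s \<inter> A t)"
    proof (rule finite_UN_I)
      have "finite (rank ` {s \<in> D. rank s < rank t})" by (rule finite_subset[of _ "{..<rank t}"]) auto
      then show "finite {s \<in> D. rank s < rank t}"
        by (rule finite_imageD) (rule inj_on_subset[OF inj], auto)
    qed (auto intro!: almost_disjoint)
    ultimately show ?thesis unfolding tendsto_along_iff by (intro allI impI) (rule finite_subset)
  qed
  have "h \<in> carrier"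
    unfolding h_def
  proof (rule restrict_in_carrier)
    show "Bseq (\<lambda>n. case Inl n :: nat + 'a of Inl n \<Rightarrow> g n | Inr x \<Rightarrow> f x)"
      using g_le by (intro BseqI'[of _ "2 * N"]) simp
  qed (use cont g_jump g_null in auto)
  moreover have "quot h = f"
    using ext by (auto simp: quot_def h_def extensional_def)
  ultimately show ?thesis using g_le by (intro that) (auto simp: h_def)
qed

lemma twisted_sum_middle: "twisted_sum c0_space middle (C_space K) embed quot"
  unfolding twisted_sum_def
proof (intro conjI)
  show "bounded_operator c0_space middle embed"
    unfolding bounded_operator_def
  proof (intro conjI ballI allI)
    show "\<exists>B. \<forall>z\<in>vcarrier c0_space. vnorm middle (embed z) \<le> B * vnorm c0_space z"
    proof (intro exI[of _ 1] ballI)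
      fix z assume "z \<in> vcarrier c0_space"
      then have z: "z \<longlonglongrightarrow> 0" by simp
      then show "vnorm middle (embed z) \<le> 1 * vnorm c0_space z"
        unfolding middle_def using c0_norm_ge[OF z]
        by (intro sup_normed_norm_le) (auto simp: embed_def points_def)
    qed
  qed (auto simp: embed_in_carrier, auto simp: embed_def middle_def c0_space_def fun_eq_iff restrict_def points_def)
  show "bounded_operator middle (C_space K) quot"
    unfolding bounded_operator_def
  proof (intro conjI ballI allI)
    fix h assume "h \<in> vcarrier middle"
    then have "continuous_map K euclideanreal (\<lambda>x. h (Inr x))" by (simp add: carrier_def)
    then have "continuous_map K euclideanreal (quot h)" by (rule continuous_map_eq) (simp add: quot_def)
    then show "quot h \<in> vcarrier (C_space K)" by (simp add: quot_def)
  next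
    show "\<exists>B. \<forall>h\<in>vcarrier middle. vnorm (C_space K) (quot h) \<le> B * vnorm middle h"
      using middle_norm_ge middle_norm_nonneg
      by (intro exI[of _ 1]) (auto simp: C_space_def quot_def intro!: sup_normed_norm_le)
  qed (auto simp: quot_def middle_def C_space_def fun_eq_iff restrict_def)
  show "inj_on embed (vcarrier c0_space)"
    by (rule inj_onI) (auto simp: embed_def fun_eq_iff restrict_def points_def split: if_splits sum.splits)
  show "embed ` vcarrier c0_space = {h \<in> vcarrier middle. quot h = vzero (C_space K)}"
  proof (intro equalityI subsetI)
    fix h assume "h \<in> embed ` vcarrier c0_space"
    then obtain z where "z \<longlonglongrightarrow> 0" "h = embed z" by auto
    then show "h \<in> {h \<in> vcarrier middle. quot h = vzero (C_space K)}"
      using embed_in_carrier by (auto simp: quot_def embed_def C_space_def)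
  next
    fix h assume "h \<in> {h \<in> vcarrier middle. quot h = vzero (C_space K)}"
    then have h: "h \<in> carrier" and "quot h = (\<lambda>x\<in>topspace K. 0)" by (auto simp: C_space_def)
    then have zero: "h (Inr x) = 0" if "x \<in> topspace K" for x
      using that by (metis quot_def restrict_apply')
    have "h = embed (\<lambda>n. h (Inl n))"
    proof (rule extensionalityI[of _ points])
      show "h \<in> extensional points" using h by (simp add: carrier_def)
      show "embed (\<lambda>n. h (Inl n)) \<in> extensional points" by (simp add: embed_def)
    qed (auto simp: embed_def points_def zero)
    with quot_zero_imp_null[OF h zero] show "h \<in> embed ` vcarrier c0_space" by auto
  qed
  show "quot ` vcarrier middle = vcarrier (C_space K)"
  proof (intro equalityI subsetI)
    fix f assume "f \<in> quot ` vcarrier middle"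
    then obtain h where h: "h \<in> carrier" "f = quot h" by auto
    then have "continuous_map K euclideanreal (\<lambda>x. h (Inr x))" by (simp add: carrier_def)
    then have "continuous_map K euclideanreal (quot h)" by (rule continuous_map_eq) (simp add: quot_def)
    then show "f \<in> vcarrier (C_space K)" using h by (simp add: quot_def)
  next
    fix f assume f: "f \<in> vcarrier (C_space K)"
    then have "continuous_map K euclideanreal f" by simp
    then obtain N where "0 \<le> N" "\<And>x. x \<in> topspace K \<Longrightarrow> \<bar>f x\<bar> \<le> N"
      using compact_space_continuous_bounded[OF compact_K] by metis
    then obtain h where "h \<in> carrier" "quot h = f" using exists_bounded_lift[OF f] by metis
    then show "f \<in> quot ` vcarrier middle" by auto
  qed
qed (rule banach_space_c0 banach_space_middle banach_space_C[OF compact_K])+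

text \<open>
  Of a bounded operator from $C(K)$ to $\ell_\infty$ that lifts the operator into $\ell_\infty/c_0$, additivity, a bound
  on the unit ball and the limits along the sets \<open>A t\<close> are recorded.
\<close>

definition jump_lifting :: "(('a \<Rightarrow> real) \<Rightarrow> nat \<Rightarrow> real) \<Rightarrow> real \<Rightarrow> bool" where
  "jump_lifting U R \<longleftrightarrow>
    (\<forall>f\<in>vcarrier (C_space K). \<forall>g\<in>vcarrier (C_space K). \<forall>n. U (vadd (C_space K) f g) n = U f n + U g n) \<and>
    (\<forall>f\<in>vcarrier (C_space K). (\<forall>x\<in>topspace K. \<bar>f x\<bar> \<le> 1) \<longrightarrow> (\<forall>n. \<bar>U f n\<bar> \<le> R)) \<and>
    (\<forall>f\<in>vcarrier (C_space K). \<forall>t. (U f \<longlongrightarrow> jump t f) (along (A t)))"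

text \<open>
  For a retraction \<open>r\<close> onto $c_0$, the sequence part of \<open>h\<close> minus \<open>r h\<close> depends only on the part of \<open>h\<close> on \<open>K\<close>.
  So \<open>h\<close> may be an arbitrary preimage when additivity is concerned, and a small one for the bound.
\<close>

lemma trivial_imp_jump_lifting:
  assumes "trivial_twisted_sum c0_space middle embed"
  obtains U R where "jump_lifting U R"
proof -
  obtain r where r: "bounded_operator middle c0_space r" and r_embed: "\<And>z. z \<longlonglongrightarrow> 0 \<Longrightarrow> r (embed z) = z"
    using assms by (auto simp: trivial_twisted_sum_def)
  have r_c0: "r h \<longlonglongrightarrow> 0" if "h \<in> carrier" for h
    using r that by (simp add: bounded_operator_def)
  have r_add: "r (\<lambda>s\<in>points. f s + g s) n = r f n + r g n" if "f \<in> carrier" "g \<in> carrier" for f g n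
    using r that by (simp add: bounded_operator_def c0_space_def middle_def)
  have "\<exists>C. \<forall>h\<in>carrier. vnorm c0_space (r h) \<le> C * vnorm middle h"
    using r by (simp add: bounded_operator_def)
  then obtain C where C: "\<And>h. h \<in> carrier \<Longrightarrow> vnorm c0_space (r h) \<le> C * vnorm middle h"
    by blast
  have same: "h (Inl n) - r h n = h' (Inl n) - r h' n"
    if h: "h \<in> carrier" "h' \<in> carrier" and eq: "\<And>x. x \<in> topspace K \<Longrightarrow> h (Inr x) = h' (Inr x)" for h h' n
  proof -
    define d where "d = (\<lambda>s\<in>points. h s + (\<lambda>s\<in>points. -1 * h' s) s)"
    have d: "d \<in> carrier" unfolding d_def by (intro carrier_add carrier_scale h)
    have null_d: "(\<lambda>n. d (Inl n)) \<longlonglongrightarrow> 0" by (rule quot_zero_imp_null[OF d]) (simp add: d_def eq)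
    have "h = (\<lambda>s\<in>points. h' s + embed (\<lambda>n. d (Inl n)) s)"
    proof (rule extensionalityI[of _ points])
      show "h \<in> extensional points" using h by (simp add: carrier_def)
    qed (auto simp: points_def embed_def d_def eq)
    then have "r h n = r h' n + d (Inl n)"
      using r_add[OF h(2) embed_in_carrier[OF null_d], of n] r_embed[OF null_d] by simp
    then show ?thesis by (simp add: d_def)
  qed
  define L where "L f = (SOME h. h \<in> carrier \<and> quot h = f)" for f
  have "\<exists>h. h \<in> carrier \<and> quot h = f" if "f \<in> vcarrier (C_space K)" for f
  proof -
    have "quot ` vcarrier middle = vcarrier (C_space K)"
      using twisted_sum_middle unfolding twisted_sum_def by (elim conjE)
    then have "f \<in> quot ` carrier" using that by simp
    then show ?thesis by auto
  qed
  then have L: "L f \<in> carrier \<and> quot (L f) = f" if "f \<in> vcarrier (C_space K)" for f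
    unfolding L_def by (rule someI_ex) (rule that)
  have L_Inr: "L f (Inr x) = f x" if "f \<in> vcarrier (C_space K)" "x \<in> topspace K" for f x
    using L[OF that(1)] that(2) by (metis quot_def restrict_apply')
  define U where "U f n = L f (Inl n) - r (L f) n" for f n
  have "jump_lifting U (2 + \<bar>C\<bar> * 2)"
    unfolding jump_lifting_def
  proof (intro conjI ballI allI impI)
    fix f g n assume fg: "f \<in> vcarrier (C_space K)" "g \<in> vcarrier (C_space K)"
    let ?h = "\<lambda>s\<in>points. L f s + L g s"
    have sum: "vadd (C_space K) f g \<in> vcarrier (C_space K)"
      using normed_space.add_closed[OF banach_space.axioms(1)[OF banach_space_C[OF compact_K]]] fg .
    have "U (vadd (C_space K) f g) n = ?h (Inl n) - r ?h n"
      unfolding U_def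
    proof (rule same)
      show "?h \<in> carrier" using L fg by (intro carrier_add) auto
      show "L (vadd (C_space K) f g) (Inr x) = ?h (Inr x)" if "x \<in> topspace K" for x
        using L_Inr[OF sum that] L_Inr[OF fg(1) that] L_Inr[OF fg(2) that] that by (simp add: C_space_def)
    qed (use L[OF sum] in simp)
    then show "U (vadd (C_space K) f g) n = U f n + U g n"
      using r_add[of "L f" "L g" n] L fg by (simp add: U_def)
  next
    fix f n assume f: "f \<in> vcarrier (C_space K)" and "\<forall>x\<in>topspace K. \<bar>f x\<bar> \<le> 1"
    then have le: "\<bar>f x\<bar> \<le> 1" if "x \<in> topspace K" for x using that by blast
    obtain h where h: "h \<in> carrier" "quot h = f" "\<And>n. \<bar>h (Inl n)\<bar> \<le> 2"
      by (rule exists_bounded_lift[OF f zero_le_one le]) simp_all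
    have h_Inr: "h (Inr x) = f x" if "x \<in> topspace K" for x
      using h(2) that by (metis quot_def restrict_apply')
    have "U f n = h (Inl n) - r h n"
      unfolding U_def using L[OF f] h(1) by (intro same) (auto simp: L_Inr[OF f] h_Inr)
    moreover have "\<bar>r h n\<bar> \<le> \<bar>C\<bar> * 2"
    proof -
      have "\<bar>h s\<bar> \<le> 2" if "s \<in> points" for s
      proof (cases s)
        case (Inr x)
        then have "x \<in> topspace K" using that by simp
        then show ?thesis using Inr le[of x] h_Inr[of x] by simp
      qed (use h(3) in simp)
      then have "vnorm middle h \<le> 2" unfolding middle_def by (intro sup_normed_norm_le) auto
      have "\<bar>r h n\<bar> \<le> vnorm c0_space (r h)" using r_c0[OF h(1)] by (rule c0_norm_ge)
      also have "\<dots> \<le> C * vnorm middle h" using C h(1) .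
      also have "\<dots> \<le> \<bar>C\<bar> * vnorm middle h"
        using middle_norm_nonneg[OF h(1)] by (intro mult_right_mono) auto
      also have "\<dots> \<le> \<bar>C\<bar> * 2" using \<open>vnorm middle h \<le> 2\<close> by (intro mult_left_mono) auto
      finally show ?thesis .
    qed
    ultimately show "\<bar>U f n\<bar> \<le> 2 + \<bar>C\<bar> * 2" using h(3)[of n] by linarith
  next
    fix f t assume f: "f \<in> vcarrier (C_space K)"
    have "((\<lambda>n. L f (Inl n)) \<longlongrightarrow> jump t (\<lambda>x. L f (Inr x))) (along (A t))"
      using L[OF f] by (simp add: carrier_def)
    moreover have "jump t (\<lambda>x. L f (Inr x)) = jump t f" by (rule jump_cong) (simp add: L_Inr[OF f])
    moreover have "(r (L f) \<longlongrightarrow> 0) (along (A t))"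
      using r_c0 L[OF f] by (intro tendsto_mono[OF _ r_c0]) (auto simp: along_def)
    ultimately have "((\<lambda>n. L f (Inl n) - r (L f) n) \<longlongrightarrow> jump t f - 0) (along (A t))"
      by (intro tendsto_diff) simp_all
    then show "(U f \<longlongrightarrow> jump t f) (along (A t))" by (simp add: U_def[abs_def])
  qed
  then show ?thesis by (rule that)
qed

end

section \<open>Diagonalizing against all liftings\<close>

text \<open>
  The sets of initial segments of the branches of the dyadic tree, with the branches indexed by the sets
  of pairs of natural numbers.
\<close>

lemma almost_disjoint_family:
  obtains A :: "(nat \<times> nat) set \<Rightarrow> nat set"
  where "\<And>t. infinite (A t)" "\<And>s t. s \<noteq> t \<Longrightarrow> finite (A s \<inter> A t)"
proof -
  define code where "code t n = prod_encode (n, set_encode (prod_encode ` t \<inter> {..<n}))"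
    for t :: "(nat \<times> nat) set" and n :: nat
  define A where "A t = range (code t)" for t
  have code_eq: "m = n \<and> prod_encode ` s \<inter> {..<n} = prod_encode ` t \<inter> {..<n}"
    if "code s m = code t n" for s t m n
    using that by (auto simp: code_def set_encode_eq)
  show ?thesis
  proof (rule that)
    fix t
    have "inj (code t)" by (rule injI) (use code_eq in blast)
    then show "infinite (A t)" unfolding A_def by (rule range_inj_infinite)
  next
    fix s t :: "(nat \<times> nat) set" assume "s \<noteq> t"
    then obtain k where k: "k \<in> prod_encode ` s \<longleftrightarrow> k \<notin> prod_encode ` t"
      by (metis inj_image_eq_iff inj_prod_encode set_eqI)
    have "A s \<inter> A t \<subseteq> code t ` {..k}"
    proof
      fix c assume "c \<in> A s \<inter> A t"
      then obtain m n where mn: "c = code s m" "c = code t n" by (metis A_def IntE imageE)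
      then have "prod_encode ` s \<inter> {..<n} = prod_encode ` t \<inter> {..<n}" using code_eq by metis
      then have "\<not> k < n" using k by blast
      then show "c \<in> code t ` {..k}" using mn(2) by auto
    qed
    then show "finite (A s \<inter> A t)" by (rule finite_subset) simp
  qed
qed

lemma harmonic_sum_unbounded: "\<exists>m. R < (\<Sum>i<m. 1 / (2 * real (Suc i)))"
proof (rule ccontr)
  assume "\<not> ?thesis"
  then have "(\<Sum>i<m. 1 / (2 * real (Suc i))) \<le> R" for m by (auto simp: not_less)
  then have "(\<Sum>i\<le>m. 1 / (2 * real (Suc i))) \<le> R" for m
    unfolding lessThan_Suc_atMost[symmetric] by blast
  then have "summable (\<lambda>i. 1 / (2 * real (Suc i)))" by (intro bounded_imp_summable[of _ R]) auto
  then have "summable (\<lambda>i. 2 * (1 / (2 * real (Suc i))))" by (rule summable_mult)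
  also have "(\<lambda>i. 2 * (1 / (2 * real (Suc i)))) = (\<lambda>i. inverse (real (Suc i)))" by (auto simp: divide_simps)
  finally have "summable (\<lambda>i. inverse (real (Suc i)))" .
  then show False using not_summable_harmonic[where 'a = real] by (subst (asm) summable_Suc_iff[of "\<lambda>n. inverse (real n)"]) simp
qed

text \<open>
  The indices \<open>t\<close> are the possible traces of a lifting. If \<open>t\<close> is the trace of one, then the jump attached to
  \<open>A t\<close> forces \<open>(c t, n) \<in> t\<close> for almost all \<open>n\<close> in \<open>A t\<close>, and \<open>c t\<close> is chosen so that this fails; it is arbitrary
  if no choice achieves this, which happens only for sets \<open>t\<close> that are not traces. The weights \<open>1 / (c t + 1)\<close> have two
  purposes. They tend to \<open>0\<close> as \<open>c t\<close> grows, so that the jumps are in $c_0$ even though \<open>c\<close> may take infinitely many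
  values; and their sum diverges, which is what makes a suitable \<open>c t\<close> exist for the trace of a lifting.
\<close>

lemma nontrivial_twisted_sum_of_localized_jumps:
  fixes K :: "'a topology" and V :: "nat \<Rightarrow> 'a set" and p q :: "nat \<Rightarrow> (nat \<times> nat) set \<Rightarrow> 'a"
  assumes K: "compact_space K" "Hausdorff_space K"
    and V: "\<And>i. openin K (V i)" "disjoint_family V"
    and p: "\<And>i t. p i t \<in> V i" and q: "\<And>i t. q i t \<in> topspace K" and pq: "\<And>i t. p i t \<noteq> q i t"
    and null: "\<And>i f e. \<lbrakk>continuous_map K euclideanreal f; 0 < e\<rbrakk> \<Longrightarrow> finite {t. e \<le> \<bar>f (p i t) - f (q i t)\<bar>}"
  shows "ex_nontrivial_twisted_sum c0_space (C_space K)"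
proof -
  obtain A :: "(nat \<times> nat) set \<Rightarrow> nat set"
    where A: "\<And>t. infinite (A t)" "\<And>s t. s \<noteq> t \<Longrightarrow> finite (A s \<inter> A t)"
    using almost_disjoint_family by metis
  define c where "c t = (SOME i. infinite {n \<in> A t. (i, n) \<notin> t})" for t
  have p_in: "p i t \<in> topspace K" for i t using p V(1) openin_subset by blast
  interpret almost_disjoint_jumps K A "\<lambda>t. 1 / real (Suc (c t))" "\<lambda>t. p (c t) t" "\<lambda>t. q (c t) t"
  proof
    fix f and e :: real assume f: "continuous_map K euclideanreal f" and e: "0 < e"
    obtain N where N: "0 \<le> N" "\<And>x. x \<in> topspace K \<Longrightarrow> \<bar>f x\<bar> \<le> N"
      using compact_space_continuous_bounded[OF K(1) f] by metis
    obtain m where m: "2 * N / e < real m" using reals_Archimedean2 by blast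
    have "{t. e \<le> \<bar>1 / real (Suc (c t)) * (f (p (c t) t) - f (q (c t) t))\<bar>} \<subseteq>
        (\<Union>i<m. {t. e \<le> \<bar>f (p i t) - f (q i t)\<bar>})"
    proof
      fix t assume "t \<in> {t. e \<le> \<bar>1 / real (Suc (c t)) * (f (p (c t) t) - f (q (c t) t))\<bar>}"
      then have large: "e * real (Suc (c t)) \<le> \<bar>f (p (c t) t) - f (q (c t) t)\<bar>"
        by (simp add: abs_mult field_simps)
      moreover have "e \<le> e * real (Suc (c t))" using e by simp
      moreover have "\<bar>f (p (c t) t) - f (q (c t) t)\<bar> \<le> 2 * N"
        using N(2)[OF p_in, of "c t" t] N(2)[OF q, of "c t" t] by linarith
      moreover have "2 * N < e * real m" using m e by (simp add: field_simps)
      ultimately have "e * real (Suc (c t)) < e * real m" "e \<le> \<bar>f (p (c t) t) - f (q (c t) t)\<bar>" by linarith+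
      then have "c t < m" using e by simp
      with \<open>e \<le> \<bar>f (p (c t) t) - f (q (c t) t)\<bar>\<close> show "t \<in> (\<Union>i<m. {t. e \<le> \<bar>f (p i t) - f (q i t)\<bar>})" by auto
    qed
    moreover have "finite (\<Union>i<m. {t. e \<le> \<bar>f (p i t) - f (q i t)\<bar>})" using null[OF f e] by auto
    ultimately show "finite {t. e \<le> \<bar>1 / real (Suc (c t)) * (f (p (c t) t) - f (q (c t) t))\<bar>}"
      by (rule finite_subset)
  qed (use K A p_in q in auto)
  let ?C = "vcarrier (C_space K)"
  have "\<not> trivial_twisted_sum c0_space middle embed"
  proof
    assume triv: "trivial_twisted_sum c0_space middle embed"
    obtain U R where U: "jump_lifting U R" using trivial_imp_jump_lifting[OF triv] .
    have U_add: "U (vadd (C_space K) f g) n = U f n + U g n" if "f \<in> ?C" "g \<in> ?C" for f g n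
      using U that unfolding jump_lifting_def by blast
    have U_le: "\<bar>U f n\<bar> \<le> R" if "f \<in> ?C" "\<forall>x\<in>topspace K. \<bar>f x\<bar> \<le> 1" for f n
      using U that unfolding jump_lifting_def by blast
    have U_jump: "(U f \<longlongrightarrow> jump t f) (along (A t))" if "f \<in> ?C" for f t
      using U that unfolding jump_lifting_def by blast
    define test where "test i = {f \<in> ?C. (\<forall>x\<in>topspace K. \<bar>f x\<bar> \<le> 1) \<and> (\<forall>x\<in>topspace K - V i. f x = 0)}" for i
    \<comment> \<open>The trace of the lifting; half of the weight \<open>1 / (i + 1)\<close> leaves room for passing to the limit.\<close>
    define E where "E = {(i, n). \<exists>f\<in>test i. 1 / (2 * real (Suc i)) < U f n}"
    have "\<exists>i. infinite {n \<in> A E. (i, n) \<notin> E}"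
    proof (rule ccontr)
      assume "\<not> ?thesis"
      then have fin: "finite {n \<in> A E. (i, n) \<notin> E}" for i by blast
      obtain m where m: "R < (\<Sum>i<m. 1 / (2 * real (Suc i)))" using harmonic_sum_unbounded by blast
      have "finite (\<Union>i<m. {n \<in> A E. (i, n) \<notin> E})" using fin by blast
      then obtain n where "n \<in> A E" "n \<notin> (\<Union>i<m. {n \<in> A E. (i, n) \<notin> E})"
        using A(1) by (meson finite_subset subsetI)
      then have "\<forall>i<m. (i, n) \<in> E" by auto
      then have "\<forall>i. \<exists>f. i < m \<longrightarrow> f \<in> test i \<and> 1 / (2 * real (Suc i)) < U f n"
        by (auto simp: E_def)
      then obtain F where F: "\<And>i. i < m \<Longrightarrow> F i \<in> test i" "\<And>i. i < m \<Longrightarrow> 1 / (2 * real (Suc i)) < U (F i) n"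
        by metis
      \<comment> \<open>The functions \<open>F i\<close> have disjoint supports, so that their sums stay in the unit ball.\<close>
      have sum: "\<exists>f\<in>?C. U f n = (\<Sum>i<k. U (F i) n) \<and> (\<forall>x\<in>topspace K. \<bar>f x\<bar> \<le> 1) \<and>
          (\<forall>x\<in>topspace K - (\<Union>i<k. V i). f x = 0)" if "k \<le> m" for k
        using that
      proof (induction k)
        case 0
        let ?z = "vzero (C_space K)"
        have z: "?z \<in> ?C" "?z = (\<lambda>x\<in>topspace K. 0)" by (auto simp: C_space_def)
        moreover have "vadd (C_space K) ?z ?z = ?z" by (auto simp: C_space_def)
        ultimately have "U ?z n = 0" using U_add[OF z(1) z(1), of n] by simp
        moreover have "\<forall>x\<in>topspace K. ?z x = 0" by (simp add: z(2))
        ultimately show ?case using z(1) by (intro bexI[of _ ?z]) auto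
      next
        case (Suc k)
        then obtain f where f: "f \<in> ?C" "U f n = (\<Sum>i<k. U (F i) n)" "\<forall>x\<in>topspace K. \<bar>f x\<bar> \<le> 1"
          "\<forall>x\<in>topspace K - (\<Union>i<k. V i). f x = 0" by auto
        have Fk: "F k \<in> ?C" "\<forall>x\<in>topspace K. \<bar>F k x\<bar> \<le> 1" "\<forall>x\<in>topspace K - V k. F k x = 0"
          using F(1)[of k] Suc.prems by (auto simp: test_def)
        let ?f = "vadd (C_space K) f (F k)"
        have val: "?f x = f x + F k x" if "x \<in> topspace K" for x using that by (simp add: C_space_def)
        have "?f \<in> ?C"
          using normed_space.add_closed[OF banach_space.axioms(1)[OF banach_space_C[OF K(1)]]] f(1) Fk(1) .
        moreover have "U ?f n = (\<Sum>i<Suc k. U (F i) n)" using U_add[OF f(1) Fk(1)] f(2) by simp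
        moreover have "\<bar>?f x\<bar> \<le> 1" if x: "x \<in> topspace K" for x
        proof (cases "x \<in> V k")
          case True
          moreover have "V i \<inter> V k = {}" if "i < k" for i
            using V(2) that by (simp add: disjoint_family_on_def)
          ultimately have "x \<notin> (\<Union>i<k. V i)" by blast
          then have "f x = 0" using f(4) x by blast
          then show ?thesis using val[OF x] Fk(2) x by simp
        next
          case False
          then have "F k x = 0" using Fk(3) x by blast
          then show ?thesis using val[OF x] f(3) x by simp
        qed
        moreover have "?f x = 0" if "x \<in> topspace K - (\<Union>i<Suc k. V i)" for x
          using that val[of x] f(4) Fk(3) by (auto simp: lessThan_Suc)
        ultimately show ?case by blast
      qed
      obtain f where f: "f \<in> ?C" "U f n = (\<Sum>i<m. U (F i) n)" "\<forall>x\<in>topspace K. \<bar>f x\<bar> \<le> 1"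
        using sum[of m] by auto
      have "(\<Sum>i<m. 1 / (2 * real (Suc i))) \<le> (\<Sum>i<m. U (F i) n)"
        using F(2) by (intro sum_mono) (auto intro: less_imp_le)
      with m f U_le[of f n] show False by auto
    qed
    then have inf: "infinite {n \<in> A E. (c E, n) \<notin> E}" unfolding c_def by (rule someI_ex)
    let ?p = "p (c E) E" and ?q = "q (c E) E" and ?\<delta> = "1 / real (Suc (c E))"
    have "?p \<noteq> ?q" by (rule pq)
    have cl_p: "closedin K {?p}" and cl_q: "closedin K {?q}"
      using p_in q K(2) by (auto intro: closedin_Hausdorff_singleton)
    have cl: "closedin K ((topspace K - V (c E)) \<union> {?q})"
      using V(1) by (intro closedin_Un cl_q) blast
    have disj: "((topspace K - V (c E)) \<union> {?q}) \<inter> {?p} = {}"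
      using p[of "c E" E] \<open>?p \<noteq> ?q\<close> by auto
    obtain f where f: "continuous_map K euclideanreal f"
      "\<forall>x\<in>topspace K. \<bar>f x\<bar> \<le> 1" "\<forall>x\<in>topspace K - V (c E). f x = 0" "f ?q = 0" "f ?p = 1"
      by (rule compact_Hausdorff_separating_function[OF K cl cl_p disj]) auto
    define f' where "f' = restrict f (topspace K)"
    have "continuous_map K euclideanreal f'" unfolding f'_def using f(1) by (rule continuous_map_eq) simp
    then have "f' \<in> test (c E)" using f(2,3) by (auto simp: test_def f'_def)
    have "jump E f' = ?\<delta>" unfolding jump_def f'_def using f(4,5) p_in q by simp
    then have "(U f' \<longlongrightarrow> ?\<delta>) (along (A E))" using U_jump[of f' E] \<open>f' \<in> test (c E)\<close> by (simp add: test_def)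
    then have "finite {n \<in> A E. ?\<delta> / 2 \<le> \<bar>U f' n - ?\<delta>\<bar>}" unfolding tendsto_along_iff by simp
    moreover have "{n \<in> A E. (c E, n) \<notin> E} \<subseteq> {n \<in> A E. ?\<delta> / 2 \<le> \<bar>U f' n - ?\<delta>\<bar>}"
    proof
      fix n assume n: "n \<in> {n \<in> A E. (c E, n) \<notin> E}"
      then have "U f' n \<le> 1 / (2 * real (Suc (c E)))"
        using \<open>f' \<in> test (c E)\<close> by (auto simp: E_def not_less)
      also have "\<dots> = ?\<delta> - ?\<delta> / 2" by (simp add: field_simps)
      finally show "n \<in> {n \<in> A E. ?\<delta> / 2 \<le> \<bar>U f' n - ?\<delta>\<bar>}" using n by auto
    qed
    ultimately show False using inf finite_subset by blast
  qed
  then show ?thesis using ex_nontrivial_twisted_sumI twisted_sum_middle by blast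
qed

section \<open>Dyadic spaces under the continuum hypothesis\<close>

lemma continuum_hypothesis_injection:
  includes cardinal_syntax
  fixes S :: "'i set"
  assumes continuum_hypothesis "uncountable S"
  obtains g :: "(nat \<times> nat) set \<Rightarrow> 'i" where "inj g" "range g \<subseteq> S"
proof -
  have "\<not> |S| \<le>o |UNIV :: nat set|"
    using assms(2) by (auto simp: countable_def card_of_ordLeq[symmetric])
  then have "\<not> |S| \<le>o natLeq" using card_of_nat ordIso_symmetric ordLeq_ordIso_trans by blast
  then have "natLeq <o |S|" by (simp add: not_ordLeq_iff_ordLess natLeq_Well_order card_of_Well_order)
  then have "cardSuc natLeq \<le>o |S|" by (intro cardSuc_least natLeq_Card_order card_of_Card_order)
  moreover have "|UNIV :: nat set set| =o cardSuc natLeq"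
    using assms(1) by (simp add: continuum_hypothesis_def)
  ultimately have "|UNIV :: nat set set| \<le>o |S|" by (rule ordIso_ordLeq_trans[rotated])
  then obtain h :: "nat set \<Rightarrow> 'i" where h: "inj h" "range h \<subseteq> S"
    by (auto simp: card_of_ordLeq[symmetric])
  show ?thesis
  proof (rule that[of "\<lambda>t. h (prod_encode ` t)"])
    show "inj (\<lambda>t. h (prod_encode ` t))"
      using h(1) by (auto intro!: injI dest!: injD simp: inj_image_eq_iff[OF inj_prod_encode])
  qed (use h(2) in auto)
qed

theorem theorem7p9:
  fixes K :: "'a topology"
  assumes continuum_hypothesis
    and "dyadic_space TYPE('i) K"
    and "\<not> metrizable_space K"
  shows "ex_nontrivial_twisted_sum c0_space (C_space K)"
proof -
  obtain I :: "'i set" and \<phi> where "compact_space K" "Hausdorff_space K"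
    "continuous_map (cantor_cube I) K \<phi>" "\<phi> ` extensional I = topspace K"
    using assms(2) by (auto simp: dyadic_space_def topspace_cantor_cube)
  then interpret dyadic_map I K \<phi> by unfold_locales
  obtain V :: "nat \<Rightarrow> 'a set" where V: "\<And>i. openin K (V i)" "disjoint_family V"
    "\<And>i. uncountable (sensitive (preimage (V i)))"
    using disjoint_open_sets_with_uncountably_many_sensitive[OF assms(3)] by metis
  have "\<exists>g :: (nat \<times> nat) set \<Rightarrow> 'i. inj g \<and> range g \<subseteq> sensitive (preimage (V i))" for i
    using continuum_hypothesis_injection[OF assms(1) V(3)] by metis
  then obtain g :: "nat \<Rightarrow> (nat \<times> nat) set \<Rightarrow> 'i"
    where g: "\<And>i. inj (g i)" "\<And>i t. g i t \<in> sensitive (preimage (V i))"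
    by (metis range_subsetD)
  have "\<exists>x. x \<in> extensional I \<and> \<phi> x \<in> V i \<and> \<phi> x \<noteq> \<phi> (flip (g i t) x)" for i t
    using g(2)[of i t] by (auto simp: sensitive_def preimage_def)
  then obtain x where x: "\<And>i t. x i t \<in> extensional I" "\<And>i t. \<phi> (x i t) \<in> V i"
    "\<And>i t. \<phi> (x i t) \<noteq> \<phi> (flip (g i t) (x i t))"
    by metis
  have gI: "g i t \<in> I" for i t using g(2)[of i t] by (simp add: sensitive_def)
  show ?thesis
  proof (rule nontrivial_twisted_sum_of_localized_jumps[OF compact_K Hausdorff_K V(1,2) x(2) _ x(3)])
    show "\<phi> (flip (g i t) (x i t)) \<in> topspace K" for i t
      using x(1) gI by (intro \<phi>_in flip_extensional)
    fix i f and e :: real assume "continuous_map K euclideanreal f" "0 < e"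
    then have "finite {s \<in> I. \<exists>y\<in>extensional I. e \<le> \<bar>f (\<phi> y) - f (\<phi> (flip s y))\<bar>}"
      by (rule finite_large_jumps)
    then have "finite (g i -` {s \<in> I. \<exists>y\<in>extensional I. e \<le> \<bar>f (\<phi> y) - f (\<phi> (flip s y))\<bar>})"
      using g(1) by (rule finite_vimageI)
    then show "finite {t. e \<le> \<bar>f (\<phi> (x i t)) - f (\<phi> (flip (g i t) (x i t)))\<bar>}"
      by (rule rev_finite_subset) (use x(1) gI in auto)
  qed
qed

end
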